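(* Let $\varepsilon>0$ and let $\mathcal{F}\subseteq[\mathcal{C}]^{<\omega}$ be an $\varepsilon$-filling family over the Cantor set $\mathcal{C}=2^\omega$. If $\mathcal{F}$ is $C$-measurable in $[\mathcal{C}]^{<\omega}$, then for every perfect $P\subseteq\mathcal{C}$ there exists a perfect $Q\subseteq P$ with $[Q]^{<\omega}\subseteq\mathcal{F}$.
   Context: $\mathcal{C}=2^\omega$ is the Cantor set and $<$ is its strict lexicographical ordering. For $P\subseteq\mathcal{C}$ and $k\geq 1$, $[P]^k$ is the set of all $k$-element subsets of $P$, identified with the $<$-increasing sequences of length $k$ in $P$ (so $[\mathcal{C}]^k$ is an open subset of $\mathcal{C}^k$, hence a Polish space), and $[P]^{<\omega}=\bigcup_{k\geq1}[P]^k$. The set $[\mathcal{C}]^{<\omega}$ is the Polish space which is the topological direct sum of the spaces $[\mathcal{C}]^k$, $k\geq1$ (the empty set plays no role). A family $\mathcal{F}\subseteq[\mathcal{C}]^{<\omega}$ is hereditary if every (nonempty) subset of a member of $\mathcal{F}$ belongs to $\mathcal{F}$. It is $\varepsilon$-filling over $\mathcal{C}$ if it is hereditary and for every $F\in[\mathcal{C}]^{<\omega}$ there is $G\subseteq F$ with $G\in\mathcal{F}$ and $|G|\geq\varepsilon|F|$. A subset of a Polish space is $C$-measurable if it belongs to the smallest $\sigma$-algebra which contains the open sets and is closed under the Souslin operation. Perfect means nonempty, closed and without isolated points. *)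

theory Defs
  imports
    "HOL-Analysis.Analysis"
    "HOL-Library.Ramsey"
    "HOL-Library.Fun_Lexorder"
begin

text \<open>
  The Cantor set is the type \<^typ>\<open>nat \<Rightarrow> bool\<close>, with the product topology of its
  type-class instance and the strict lexicographic order \<^const>\<open>less_fun\<close> (where False < True).
\<close>

type_synonym cantor = "nat \<Rightarrow> bool"

definition perfect :: "'a::topological_space set \<Rightarrow> bool" where
  "perfect P \<longleftrightarrow> P \<noteq> {} \<and> closed P \<and> (\<forall>x. \<not> x isolated_in P)"

definition finsets :: "'a set \<Rightarrow> 'a set set" where
  "finsets P = (\<Union>k\<in>{1..}. [P]\<^bsup>k\<^esup>)"

text \<open>
  Sequences of length \<open>k\<close> are functions on \<open>{..<k}\<close>, extensional so that they
  form the carrier of the library's product topology.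
\<close>

definition incr_seqs :: "nat \<Rightarrow> (nat \<Rightarrow> cantor) set" where
  "incr_seqs k = {s \<in> {..<k} \<rightarrow>\<^sub>E UNIV. \<forall>i j. i < j \<and> j < k \<longrightarrow> less_fun (s i) (s j)}"

definition incr_seq_topology :: "nat \<Rightarrow> (nat \<Rightarrow> cantor) topology" where
  "incr_seq_topology k = subtopology (product_topology (\<lambda>_. euclidean) {..<k}) (incr_seqs k)"

definition incr_enum :: "cantor set \<Rightarrow> nat \<Rightarrow> cantor" where
  "incr_enum F = (THE s. s \<in> incr_seqs (card F) \<and> s ` {..<card F} = F)"

text \<open>
  The direct sum of the spaces of \<open>k\<close>-element sets, \<open>k \<ge> 1\<close>, transported along the
  identification of a finite set with its increasing enumeration
  (a homeomorphism by \<open>homeomorphic_map_finsets\<close> below).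
\<close>

definition finsets_topology :: "cantor set topology" where
  "finsets_topology =
     pullback_topology (finsets UNIV) (\<lambda>F. (card F, incr_enum F))
       (sum_topology incr_seq_topology {1..})"

definition hereditary :: "'a set set \<Rightarrow> bool" where
  "hereditary \<F> \<longleftrightarrow> (\<forall>F\<in>\<F>. \<forall>G\<subseteq>F. G \<noteq> {} \<longrightarrow> G \<in> \<F>)"

definition filling :: "real \<Rightarrow> cantor set set \<Rightarrow> bool" where
  "filling \<epsilon> \<F> \<longleftrightarrow>
     \<F> \<subseteq> finsets UNIV \<and> hereditary \<F> \<and>
     (\<forall>F\<in>finsets UNIV. \<exists>G\<subseteq>F. G \<in> \<F> \<and> real (card G) \<ge> \<epsilon> * real (card F))"

text \<open>A Souslin scheme is indexed by the finite sequences of natural numbers;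
  \<open>map x [0..<n]\<close> is the restriction of \<open>x\<close> to its first \<open>n\<close> entries.\<close>

definition souslin :: "(nat list \<Rightarrow> 'a set) \<Rightarrow> 'a set" where
  "souslin A = (\<Union>x::nat \<Rightarrow> nat. \<Inter>n. A (map x [0..<n]))"

definition C_sets :: "'a topology \<Rightarrow> 'a set set" where
  "C_sets X = \<Inter>{M. sigma_algebra (topspace X) M \<and> {U. openin X U} \<subseteq> M \<and>
                    (\<forall>A. range A \<subseteq> M \<longrightarrow> souslin A \<in> M)}"

definition C_measurable_in :: "'a topology \<Rightarrow> 'a set \<Rightarrow> bool" where
  "C_measurable_in X S \<longleftrightarrow> S \<in> C_sets X"

lemma C_sets_subset: "C_sets X \<subseteq> Pow (topspace X)"
proof -
  have "souslin A \<subseteq> topspace X" if "range A \<subseteq> Pow (topspace X)" for A :: "nat list \<Rightarrow> 'a set"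
    using that unfolding souslin_def by fastforce
  then show ?thesis
    unfolding C_sets_def
    by (intro Inter_lower) (auto simp: sigma_algebra_Pow dest: openin_subset)
qed

lemma sigma_algebra_C_sets: "sigma_algebra (topspace X) (C_sets X)"
proof -
  have "\<Union>(range A) \<in> C_sets X" if A: "range A \<subseteq> C_sets X" for A :: "nat \<Rightarrow> _"
    unfolding C_sets_def
  proof (rule InterI, clarify)
    fix M
    assume M: "sigma_algebra (topspace X) M" "{U. openin X U} \<subseteq> M"
      "\<forall>A. range A \<subseteq> M \<longrightarrow> souslin A \<in> M"
    have "C_sets X \<subseteq> M"
      unfolding C_sets_def using M by (intro Inter_lower) simp
    then show "\<Union>(range A) \<in> M"
      using A M(1) by (simp add: sigma_algebra_iff2)
  qed
  then show ?thesis
    unfolding sigma_algebra_iff2 using C_sets_subset[of X]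
    by (auto simp: C_sets_def sigma_algebra_iff2)
qed

lemma finsets_eq: "finsets P = {F. F \<subseteq> P \<and> finite F \<and> F \<noteq> {}}"
  by (auto simp: finsets_def nsets_def Suc_le_eq card_gt_0_iff)

lemma less_fun_total:
  fixes f g :: "nat \<Rightarrow> 'b::linorder"
  shows "less_fun f g \<or> f = g \<or> less_fun g f"
proof (cases "f = g")
  case False
  then have ex: "\<exists>k. f k \<noteq> g k" by auto
  define k where "k = (LEAST k. f k \<noteq> g k)"
  have "f k \<noteq> g k" unfolding k_def using ex by (rule LeastI_ex)
  moreover have "f i = g i" if "i < k" for i
    using that not_less_Least unfolding k_def by blast
  ultimately show ?thesis
    unfolding less_fun_def by (metis linorder_neqE)
qed simp

lemma linorder_less_fun:
  "class.linorder (\<lambda>f g. less_fun f g \<or> f = g) (less_fun :: (nat \<Rightarrow> 'b::linorder) \<Rightarrow> _)"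
proof -
  interpret order "\<lambda>f g. less_fun f g \<or> f = g" "less_fun :: (nat \<Rightarrow> 'b) \<Rightarrow> _"
    by (rule order_less_fun)
  show ?thesis
    by unfold_locales (use less_fun_total in blast)
qed

lemma bij_betw_incr_seqs: "bij_betw (\<lambda>s. s ` {..<k}) (incr_seqs k) ([UNIV]\<^bsup>k\<^esup>)"
proof -
  interpret L: linorder "\<lambda>f g. less_fun f g \<or> f = g" "less_fun :: cantor \<Rightarrow> _"
    by (rule linorder_less_fun)
  have srt: "sorted_wrt less_fun (map s [0..<k])" if "s \<in> incr_seqs k" for s
    using that by (auto simp: incr_seqs_def sorted_wrt_iff_nth_less)
  have set: "set (map s [0..<k]) = s ` {..<k}" for s :: "nat \<Rightarrow> cantor"
    by (simp add: atLeast0LessThan)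
  show ?thesis
    unfolding bij_betw_def
  proof (intro conjI inj_onI set_eqI iffI)
    fix s t assume st: "s \<in> incr_seqs k" "t \<in> incr_seqs k" "s ` {..<k} = t ` {..<k}"
    then have "map s [0..<k] = map t [0..<k]"
      by (metis L.strict_sorted_equal srt set)
    then have "s i = t i" if "i < k" for i
      using that by simp
    with st show "s = t"
      unfolding incr_seqs_def by (auto intro!: PiE_ext[of s "{..<k}" "\<lambda>_. UNIV" t])
  next
    fix F assume "F \<in> (\<lambda>s. s ` {..<k}) ` incr_seqs k"
    then obtain s where s: "s \<in> incr_seqs k" "F = s ` {..<k}" by auto
    have "distinct (map s [0..<k])"
      using srt[OF s(1)] L.strict_sorted_iff by blast
    then have "inj_on s {..<k}"
      by (simp add: distinct_map atLeast0LessThan)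
    then show "F \<in> [UNIV]\<^bsup>k\<^esup>"
      using s by (simp add: nsets_def card_image)
  next
    fix F :: "cantor set" assume "F \<in> [UNIV]\<^bsup>k\<^esup>"
    then have F: "finite F" "card F = k" by (auto simp: nsets_def)
    define xs where "xs = L.sorted_list_of_set F"
    have xs: "sorted_wrt less_fun xs" "set xs = F" "length xs = k"
      using F by (simp_all add: xs_def)
    define s where "s = restrict (\<lambda>i. xs ! i) {..<k}"
    have "s \<in> incr_seqs k"
      using xs by (auto simp: incr_seqs_def s_def sorted_wrt_iff_nth_less)
    moreover have "s ` {..<k} = F"
      using xs by (auto simp: s_def in_set_conv_nth)
    ultimately show "F \<in> (\<lambda>s. s ` {..<k}) ` incr_seqs k" by blast
  qed
qed

lemma incr_enum:
  assumes "finite F"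
  shows "incr_enum F \<in> incr_seqs (card F)" "incr_enum F ` {..<card F} = F"
proof -
  have "F \<in> [UNIV]\<^bsup>card F\<^esup>" using assms by (simp add: nsets_def)
  then obtain s where "s \<in> incr_seqs (card F)" "s ` {..<card F} = F"
    using bij_betw_imp_surj_on[OF bij_betw_incr_seqs[of "card F"]] by (metis imageE)
  moreover have "t = s" if "t \<in> incr_seqs (card F)" "t ` {..<card F} = s ` {..<card F}" for t
    using inj_onD[OF bij_betw_imp_inj_on[OF bij_betw_incr_seqs[of "card F"]]] that calculation
    by blast
  ultimately have "\<exists>!s. s \<in> incr_seqs (card F) \<and> s ` {..<card F} = F"
    by metis
  from theI'[OF this] show "incr_enum F \<in> incr_seqs (card F)" "incr_enum F ` {..<card F} = F"
    by (simp_all add: incr_enum_def)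
qed

lemma incr_enum_image:
  assumes "s \<in> incr_seqs k"
  shows "card (s ` {..<k}) = k" "incr_enum (s ` {..<k}) = s"
proof -
  have "s ` {..<k} \<in> [UNIV]\<^bsup>k\<^esup>"
    using bij_betw_incr_seqs[of k] assms unfolding bij_betw_def by blast
  then show c: "card (s ` {..<k}) = k" by (simp add: nsets_def)
  have "incr_enum (s ` {..<k}) \<in> incr_seqs k" "incr_enum (s ` {..<k}) ` {..<k} = s ` {..<k}"
    using incr_enum[of "s ` {..<k}"] by (simp_all add: c)
  then show "incr_enum (s ` {..<k}) = s"
    using assms by (intro inj_onD[OF bij_betw_imp_inj_on[OF bij_betw_incr_seqs[of k]]])
qed

lemma topspace_incr_seq_topology [simp]: "topspace (incr_seq_topology k) = incr_seqs k"
  by (auto simp: incr_seq_topology_def incr_seqs_def)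

lemma topspace_finsets_topology [simp]: "topspace finsets_topology = finsets UNIV"
  by (auto simp: finsets_topology_def topspace_pullback_topology finsets_eq incr_enum
      Suc_le_eq card_gt_0_iff)

lemma homeomorphic_map_finsets:
  "homeomorphic_map finsets_topology (sum_topology incr_seq_topology {1..})
     (\<lambda>F. (card F, incr_enum F))"
    (is "homeomorphic_map ?X ?Y ?f")
proof -
  have inj: "inj_on ?f (topspace ?X)"
  proof (rule inj_onI)
    fix F G assume FG: "F \<in> topspace ?X" "G \<in> topspace ?X" "?f F = ?f G"
    have "incr_enum F ` {..<card F} = F" "incr_enum G ` {..<card G} = G"
      using FG(1,2) by (simp_all add: finsets_eq incr_enum)
    with FG(3) show "F = G" by (metis Pair_inject)
  qed
  have surj: "?f ` topspace ?X = topspace ?Y"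
  proof (intro set_eqI iffI)
    fix p assume "p \<in> topspace ?Y"
    then obtain k s where ks: "p = (k, s)" "k \<ge> 1" "s \<in> incr_seqs k" by auto
    then have "p = ?f (s ` {..<k})" using incr_enum_image by simp
    moreover have "s ` {..<k} \<in> topspace ?X"
      using ks by (auto simp: finsets_eq lessThan_empty_iff)
    ultimately show "p \<in> ?f ` topspace ?X" by blast
  qed (auto simp: finsets_eq incr_enum Suc_le_eq card_gt_0_iff)
  have X: "openin ?X S \<longleftrightarrow> (\<exists>U. openin ?Y U \<and> S = ?f -` U \<inter> topspace ?X)" for S
    unfolding topspace_finsets_topology
    by (simp only: finsets_topology_def openin_pullback_topology)
  have "openin ?Y (?f ` S)" if S: "openin ?X S" for S
  proof -
    obtain U where U: "openin ?Y U" "S = ?f -` U \<inter> topspace ?X"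
      using S X by blast
    have "?f ` S = U \<inter> ?f ` topspace ?X"
      unfolding U(2) by blast
    also have "\<dots> = U"
      using openin_subset[OF U(1)] unfolding surj by (rule Int_absorb2)
    finally show ?thesis using U(1) by (simp only:)
  qed
  then have op: "open_map ?X ?Y ?f"
    unfolding open_map_def by blast
  have pre: "openin ?X (?f -` U \<inter> topspace ?X)" if "openin ?Y U" for U
    using that X by blast
  have maps: "?f \<in> topspace ?X \<rightarrow> topspace ?Y"
    by (rule funcsetI) (use surj in blast)
  have "continuous_map ?X ?Y ?f"
    unfolding continuous_map_alt by (intro conjI allI impI pre maps)
  then show ?thesis
    by (rule bijective_open_imp_homeomorphic_map[OF _ op surj inj])
qed

end

(* A C-measurable family has, in each power of P, the Baire property, since the
   Souslin operation preserves it.  A Mycielski-type fusion therefore yields a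
   copy e of the Cantor set inside P on which membership of a finite set e`A in
   the family depends only on the restrictions of the points of A to any level n
   that separates them.  The family thus induces a hereditary family of subsets
   of each level of the binary tree, and filling provides, at level n, members
   with at least epsilon 2^n nodes.  Restricting to a lower level preserves both
   properties, so Koenig's lemma produces a tree whose branches form a closed set
   of measure at least epsilon, all of whose finite subsets are good.  Being
   uncountable, it contains a perfect set. *)

theory Submission
  imports Defs
begin

section \<open>The Baire property relative to a countable base\<close>

text \<open>Inside a box of tuples the Baire property decides membership only off a meager set, and
  the decision may differ from box to box; hence the homogeneity reached is tied to positions in the
  tree and not to the size of a set alone. A single \<open>e\<close> must serve all sizes
  \<open>k\<close> at once: stage \<open>n\<close> of the fusion treats every injective tuple of
  level-\<open>n\<close> nodes, shrinks its box until membership is decided, and makes it avoid the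
  first \<open>n\<close> nowhere dense pieces of the meager set for \<open>k\<close>. A set
  separated at one level is separated at all later ones, so its image avoids all pieces. Nodes of
  level \<open>n\<close> are coded as points that are \<open>False\<close> from \<open>n\<close> on,
  so \<open>e\<close> applies to nodes, and filling can be used on the images of the 2^n nodes. The
  bound \<epsilon> 2^n passes to the level below because a node has only two children.\<close>

locale category_base =
  fixes \<B> :: "'a set set"
  assumes countable_base: "countable \<B>"
    and base_Int: "\<And>B C x. B \<in> \<B> \<Longrightarrow> C \<in> \<B> \<Longrightarrow> x \<in> B \<Longrightarrow> x \<in> C \<Longrightarrow> \<exists>D\<in>\<B>. x \<in> D \<and> D \<subseteq> B \<inter> C"
begin

definition nowhere_dense :: "'a set \<Rightarrow> bool" where
  "nowhere_dense S \<longleftrightarrow> (\<forall>B\<in>\<B>. \<exists>C\<in>\<B>. C \<subseteq> B \<and> C \<inter> S = {})"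

definition meager :: "'a set \<Rightarrow> bool" where
  "meager S \<longleftrightarrow> (\<exists>N::nat \<Rightarrow> 'a set. (\<forall>n. nowhere_dense (N n)) \<and> S \<subseteq> (\<Union>n. N n))"

text \<open>The local form of being open up to a meager set: the union of the basic sets in which
  \<open>S\<close> is comeager differs from \<open>S\<close> by a meager set, as the base is
  countable. This form is symmetric under complement and directly supplies the small box that the
  fusion asks for.\<close>

definition baire :: "'a set \<Rightarrow> bool" where
  "baire S \<longleftrightarrow> (\<forall>B\<in>\<B>. \<exists>C\<in>\<B>. C \<subseteq> B \<and> (meager (C \<inter> S) \<or> meager (C - S)))"

lemma nowhere_dense_meager: "nowhere_dense S \<Longrightarrow> meager S"
  unfolding meager_def by (rule exI[of _ "\<lambda>_. S"]) auto

lemma nowhere_dense_empty: "nowhere_dense {}"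
  unfolding nowhere_dense_def by auto

lemma meager_empty: "meager {}"
  by (intro nowhere_dense_meager nowhere_dense_empty)

lemma meager_subset: "meager T \<Longrightarrow> S \<subseteq> T \<Longrightarrow> meager S"
  unfolding meager_def by blast

lemma meager_UN_nat:
  assumes "\<And>n::nat. meager (S n)"
  shows "meager (\<Union>n. S n)"
proof -
  have "\<forall>n. \<exists>N::nat \<Rightarrow> 'a set. (\<forall>i. nowhere_dense (N i)) \<and> S n \<subseteq> (\<Union>i. N i)"
    using assms unfolding meager_def by blast
  then obtain N where N: "\<And>n i::nat. nowhere_dense (N n i)" "\<And>n. S n \<subseteq> (\<Union>i. N n i)"
    by metis
  have "nowhere_dense (case_prod N (prod_decode p))" for p
    by (cases "prod_decode p") (simp add: N)
  moreover have "(\<Union>n. S n) \<subseteq> (\<Union>p. case_prod N (prod_decode p))"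
  proof
    fix x assume "x \<in> (\<Union>n. S n)"
    then obtain n i where "x \<in> N n i" using N(2) by blast
    then have "x \<in> case_prod N (prod_decode (prod_encode (n, i)))" by simp
    then show "x \<in> (\<Union>p. case_prod N (prod_decode p))" by (rule UN_I[OF UNIV_I])
  qed
  ultimately show ?thesis
    unfolding meager_def by (intro exI[of _ "\<lambda>p. case_prod N (prod_decode p)"]) auto
qed

lemma meager_UN:
  assumes "countable I" "\<And>i. i \<in> I \<Longrightarrow> meager (S i)"
  shows "meager (\<Union>i\<in>I. S i)"
proof (cases "I = {}")
  case False
  have "meager (\<Union>n. S (from_nat_into I n))"
    by (intro meager_UN_nat assms(2) from_nat_into False)
  moreover have "(\<Union>i\<in>I. S i) \<subseteq> (\<Union>n. S (from_nat_into I n))"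
    using from_nat_into_surj[OF assms(1)] by blast
  ultimately show ?thesis by (rule meager_subset)
qed (simp add: meager_empty)

lemma meager_Un: "meager S \<Longrightarrow> meager T \<Longrightarrow> meager (S \<union> T)"
  using meager_UN[of "{S, T}" id] by auto

text \<open>Banach's category theorem for a countable base: the part of \<open>S\<close> inside the
  countably many basic sets where \<open>S\<close> is meager is meager, and the rest misses some
  basic set inside every basic set.\<close>

lemma meager_if_locally_meager:
  assumes "\<And>B. B \<in> \<B> \<Longrightarrow> \<exists>C\<in>\<B>. C \<subseteq> B \<and> meager (C \<inter> S)"
  shows "meager S"
proof -
  define W where "W = (\<Union>C\<in>{C\<in>\<B>. meager (C \<inter> S)}. C \<inter> S)"
  have "meager W"
    unfolding W_def by (intro meager_UN) (auto intro: countable_subset[OF _ countable_base])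
  moreover have "nowhere_dense (S - W)"
    unfolding nowhere_dense_def
  proof
    fix B assume "B \<in> \<B>"
    with assms obtain C where "C \<in> \<B>" "C \<subseteq> B" "meager (C \<inter> S)" by blast
    then show "\<exists>C\<in>\<B>. C \<subseteq> B \<and> C \<inter> (S - W) = {}"
      unfolding W_def by (intro bexI[of _ C]) auto
  qed
  ultimately have "meager (W \<union> (S - W))"
    using nowhere_dense_meager meager_Un by blast
  then show ?thesis by (rule meager_subset) blast
qed

lemma meager_Int_if_locally_meager:
  assumes "B \<in> \<B>" "\<And>C. C \<in> \<B> \<Longrightarrow> C \<subseteq> B \<Longrightarrow> \<exists>D\<in>\<B>. D \<subseteq> C \<and> meager (D \<inter> S)"
  shows "meager (B \<inter> S)"
proof (rule meager_if_locally_meager)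
  fix C assume C: "C \<in> \<B>"
  show "\<exists>D\<in>\<B>. D \<subseteq> C \<and> meager (D \<inter> (B \<inter> S))"
  proof (cases "C \<inter> B = {}")
    case True
    then have "C \<inter> (B \<inter> S) = {}" by blast
    then show ?thesis using C meager_empty by (intro bexI[of _ C]) auto
  next
    case False
    then obtain E where "E \<in> \<B>" "E \<subseteq> C \<inter> B" using base_Int[OF C assms(1)] by blast
    with assms(2)[of E] obtain D where "D \<in> \<B>" "D \<subseteq> E" "meager (D \<inter> S)" by blast
    with \<open>E \<subseteq> C \<inter> B\<close> show ?thesis
      by (intro bexI[of _ D]) (auto intro: meager_subset)
  qed
qed

lemma baire_Compl: "baire S \<Longrightarrow> baire (- S)"
proof -
  have "C \<inter> - S = C - S" "C - - S = C \<inter> S" for C by auto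
  then show "baire S \<Longrightarrow> baire (- S)" unfolding baire_def by metis
qed

text \<open>Either some \<open>S n\<close> is comeager in a part of \<open>B\<close>, which settles
  the union there, or every \<open>S n\<close> is locally meager in \<open>B\<close>, hence meager
  in \<open>B\<close>, and so is the union.\<close>

lemma baire_UN:
  assumes S: "\<And>n::nat. baire (S n)"
  shows "baire (\<Union>n. S n)"
  unfolding baire_def
proof
  fix B assume B: "B \<in> \<B>"
  show "\<exists>C\<in>\<B>. C \<subseteq> B \<and> (meager (C \<inter> (\<Union>n. S n)) \<or> meager (C - (\<Union>n. S n)))"
  proof (cases "\<exists>n. \<exists>C\<in>\<B>. C \<subseteq> B \<and> meager (C - S n)")
    case True
    then obtain n C where "C \<in> \<B>" "C \<subseteq> B" "meager (C - S n)" by blast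
    moreover have "C - (\<Union>n. S n) \<subseteq> C - S n" by blast
    ultimately show ?thesis using meager_subset by blast
  next
    case False
    have "meager (B \<inter> S n)" for n
    proof (rule meager_Int_if_locally_meager[OF B])
      fix C assume "C \<in> \<B>" "C \<subseteq> B"
      with S[of n] False show "\<exists>D\<in>\<B>. D \<subseteq> C \<and> meager (D \<inter> S n)"
        unfolding baire_def by (meson subset_trans)
    qed
    then have "meager (\<Union>n. B \<inter> S n)" by (rule meager_UN_nat)
    then have "meager (B \<inter> (\<Union>n. S n))" by (rule meager_subset) blast
    with B show ?thesis by blast
  qed
qed

lemma baire_Int:
  assumes "baire S" "baire T"
  shows "baire (S \<inter> T)"
proof -
  define A where "A n = (if n = 0 then - S else - T)" for n :: nat
  have "baire (A n)" for n
    using assms by (simp add: A_def baire_Compl)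
  then have "baire (- (\<Union>n. A n))"
    by (rule baire_Compl[OF baire_UN])
  moreover have "(\<Union>n. A n) = A 0 \<union> A 1"
    unfolding A_def by (auto; metis)
  moreover have "- (A 0 \<union> A 1) = S \<inter> T"
    by (simp add: A_def)
  ultimately show ?thesis by (simp only:)
qed

lemma baire_Diff: "baire S \<Longrightarrow> baire T \<Longrightarrow> baire (S - T)"
  unfolding Diff_eq by (rule baire_Int[OF _ baire_Compl])

text \<open>Openness is tested only at points covered by the base: tuples with an entry outside
  \<open>P\<close> lie in no box.\<close>

lemma baire_open:
  assumes "\<And>x B. x \<in> S \<Longrightarrow> B \<in> \<B> \<Longrightarrow> x \<in> B \<Longrightarrow> \<exists>C\<in>\<B>. x \<in> C \<and> C \<subseteq> S"
  shows "baire S"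
  unfolding baire_def
proof
  fix B assume B: "B \<in> \<B>"
  show "\<exists>C\<in>\<B>. C \<subseteq> B \<and> (meager (C \<inter> S) \<or> meager (C - S))"
  proof (cases "B \<inter> S = {}")
    case True
    then have "meager (B \<inter> S)" by (simp only: meager_empty)
    with B show ?thesis by blast
  next
    case False
    then obtain x where x: "x \<in> B" "x \<in> S" by blast
    with assms[OF x(2) B] obtain C where "C \<in> \<B>" "x \<in> C" "C \<subseteq> S" by blast
    with base_Int[OF B _ x(1)] obtain D where D: "D \<in> \<B>" "D \<subseteq> B \<inter> S" by blast
    then have "D - S = {}" by blast
    then have "meager (D - S)" by (simp only: meager_empty)
    with D show ?thesis by blast
  qed
qed

lemma baire_if_meager_Diff:
  assumes "baire T" "S \<subseteq> T" "meager (T - S)"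
  shows "baire S"
  unfolding baire_def
proof
  fix B assume "B \<in> \<B>"
  with assms(1) obtain C where C: "C \<in> \<B>" "C \<subseteq> B" "meager (C \<inter> T) \<or> meager (C - T)"
    unfolding baire_def by blast
  from C(3) have "meager (C \<inter> S) \<or> meager (C - S)"
  proof
    assume "meager (C \<inter> T)"
    then have "meager (C \<inter> S)" by (rule meager_subset) (use assms(2) in blast)
    then show ?thesis ..
  next
    assume "meager (C - T)"
    then have "meager ((C - T) \<union> (T - S))" using assms(3) by (rule meager_Un)
    then have "meager (C - S)" by (rule meager_subset) blast
    then show ?thesis ..
  qed
  with C show "\<exists>C\<in>\<B>. C \<subseteq> B \<and> (meager (C \<inter> S) \<or> meager (C - S))" by blast
qed

text \<open>The least set with the Baire property above \<open>S\<close>, up to meager sets.\<close>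

definition envelope :: "'a set \<Rightarrow> 'a set" where
  "envelope S = S \<union> - (\<Union>{C\<in>\<B>. meager (C \<inter> S)})"

lemma subset_envelope: "S \<subseteq> envelope S"
  unfolding envelope_def by blast

lemma baire_envelope: "baire (envelope S)"
  unfolding baire_def
proof
  fix B assume B: "B \<in> \<B>"
  show "\<exists>C\<in>\<B>. C \<subseteq> B \<and> (meager (C \<inter> envelope S) \<or> meager (C - envelope S))"
  proof (cases "\<exists>C\<in>\<B>. C \<subseteq> B \<and> meager (C \<inter> S)")
    case True
    then obtain C where C: "C \<in> \<B>" "C \<subseteq> B" "meager (C \<inter> S)" by blast
    then have "C \<inter> envelope S = C \<inter> S" unfolding envelope_def by blast
    with C(3) have "meager (C \<inter> envelope S)" by (simp only:)
    with C show ?thesis by blast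
  next
    case False
    have "x \<notin> C" if x: "x \<in> B" and C: "C \<in> \<B>" "meager (C \<inter> S)" for x C
    proof
      assume "x \<in> C"
      then obtain D where D: "D \<in> \<B>" "D \<subseteq> B \<inter> C" using base_Int[OF B C(1) x] by blast
      have "meager (D \<inter> S)" using C(2) by (rule meager_subset) (use D in blast)
      with False D show False by blast
    qed
    then have "B - envelope S = {}" unfolding envelope_def by blast
    then have "meager (B - envelope S)" by (simp only: meager_empty)
    with B show ?thesis by blast
  qed
qed

text \<open>Minimality of the envelope. If \<open>E\<close> were comeager in a basic set,
  \<open>S\<close> would be meager there, and then the envelope adds nothing to \<open>S\<close> in
  that basic set.\<close>

lemma meager_if_baire_in_envelope:
  assumes "baire E" "E \<subseteq> envelope S - S"
  shows "meager E"
proof (rule meager_if_locally_meager)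
  fix B assume "B \<in> \<B>"
  with assms(1) obtain C where C: "C \<in> \<B>" "C \<subseteq> B" "meager (C \<inter> E) \<or> meager (C - E)"
    unfolding baire_def by blast
  have "meager (C \<inter> E)" if "meager (C - E)"
  proof -
    have "meager (C \<inter> S)" using that by (rule meager_subset) (use assms(2) in blast)
    with C(1) assms(2) have "C \<inter> E = {}" unfolding envelope_def by blast
    then show ?thesis by (simp only: meager_empty)
  qed
  with C show "\<exists>C\<in>\<B>. C \<subseteq> B \<and> meager (C \<inter> E)" by blast
qed

text \<open>The envelopes of the sets \<open>S l\<close> form a scheme with the Baire property whose
  Souslin set is \<open>souslin A\<close> up to the countably many meager sets
  \<open>N l\<close>.\<close>

lemma baire_souslin:
  assumes A: "\<And>l. baire (A l)"
  shows "baire (souslin A)"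
proof -
  define S where "S l = {a. \<exists>x. map x [0..<length l] = l \<and> (\<forall>n. a \<in> A (map x [0..<n]))}" for l
  define H where "H l = envelope (S l) \<inter> A l" for l
  \<comment> \<open>The points at which a branch through \<open>l\<close> gets stuck: in
    \<open>H l\<close> but in no \<open>H\<close> one step further.\<close>
  define N where "N l = H l - (\<Union>n. H (l @ [n]))" for l
  have baire_H: "baire (H l)" for l
    unfolding H_def by (intro baire_Int baire_envelope A)
  have S_H: "S l \<subseteq> H l" for l
  proof
    fix a assume a: "a \<in> S l"
    then obtain x where "map x [0..<length l] = l" "a \<in> A (map x [0..<length l])"
      unfolding S_def by blast
    then have "a \<in> A l" by simp
    with a subset_envelope[of "S l"] show "a \<in> H l" unfolding H_def by blast
  qed
  have S_step: "S l \<subseteq> (\<Union>n. S (l @ [n]))" for l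
  proof
    fix a assume "a \<in> S l"
    then obtain x where x: "map x [0..<length l] = l" "\<forall>n. a \<in> A (map x [0..<n])"
      unfolding S_def by blast
    then have "a \<in> S (l @ [x (length l)])"
      unfolding S_def by (auto intro!: exI[of _ x])
    then show "a \<in> (\<Union>n. S (l @ [n]))" by blast
  qed
  have meager_N: "meager (N l)" for l
  proof (rule meager_if_baire_in_envelope)
    show "baire (N l)" unfolding N_def by (intro baire_Diff baire_H baire_UN)
    have "S l \<subseteq> (\<Union>n. H (l @ [n]))" using S_step S_H by blast
    then show "N l \<subseteq> envelope (S l) - S l" by (auto simp: N_def H_def[of l])
  qed
  have "H [] - souslin A \<subseteq> (\<Union>l. N l)"
  proof
    fix a assume a: "a \<in> H [] - souslin A"
    show "a \<in> (\<Union>l. N l)"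
    proof (rule ccontr)
      assume "a \<notin> (\<Union>l. N l)"
      then have "\<exists>n. a \<in> H l \<longrightarrow> a \<in> H (l @ [n])" for l unfolding N_def by blast
      then obtain c where c: "\<And>l. a \<in> H l \<Longrightarrow> a \<in> H (l @ [c l])" by metis
      \<comment> \<open>Following the choices \<open>c\<close> from the root never gets stuck;
        \<open>p n\<close> is the restriction to \<open>n\<close> of the branch with entries
        \<open>c (p i)\<close>.\<close>
      define p where "p = rec_nat [] (\<lambda>_ l. l @ [c l])"
      have p: "p 0 = []" "p (Suc n) = p n @ [c (p n)]" for n by (simp_all add: p_def)
      have p_eq: "p n = map (\<lambda>i. c (p i)) [0..<n]" for n by (induction n) (simp_all add: p)
      have "a \<in> H (p n)" for n
      proof (induction n)
        case 0
        show ?case using a by (simp add: p)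
      next
        case (Suc n)
        then show ?case using c[of "p n"] by (simp add: p)
      qed
      then have "a \<in> A (map (\<lambda>i. c (p i)) [0..<n])" for n
        using p_eq[of n] unfolding H_def by (metis IntD2)
      then have "a \<in> souslin A" unfolding souslin_def by blast
      with a show False by blast
    qed
  qed
  then have "meager (H [] - souslin A)"
    by (rule meager_subset[rotated]) (intro meager_UN meager_N countableI_type)
  moreover have "souslin A = S []"
    by (auto simp: souslin_def S_def)
  ultimately show ?thesis
    using baire_if_meager_Diff[OF baire_H[of "[]"] S_H[of "[]"]] by simp
qed

text \<open>The point is that a single meager set works for all members of the base.\<close>

lemma baire_decided:
  assumes "baire S"
  obtains N :: "nat \<Rightarrow> 'a set" where "\<And>n. nowhere_dense (N n)"
    "\<And>B. B \<in> \<B> \<Longrightarrow> \<exists>C\<in>\<B>. C \<subseteq> B \<and> (C \<inter> S \<subseteq> (\<Union>n. N n) \<or> C - S \<subseteq> (\<Union>n. N n))"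
proof -
  define M where "M = (\<Union>C\<in>{C\<in>\<B>. meager (C \<inter> S)}. C \<inter> S) \<union> (\<Union>C\<in>{C\<in>\<B>. meager (C - S)}. C - S)"
  have "meager M"
    unfolding M_def
    by (intro meager_Un meager_UN) (auto intro: countable_subset[OF _ countable_base])
  then obtain N :: "nat \<Rightarrow> 'a set" where N: "\<And>n. nowhere_dense (N n)" "M \<subseteq> (\<Union>n. N n)"
    unfolding meager_def by blast
  show ?thesis
  proof (rule that)
    fix B assume "B \<in> \<B>"
    with assms obtain C where C: "C \<in> \<B>" "C \<subseteq> B" "meager (C \<inter> S) \<or> meager (C - S)"
      unfolding baire_def by blast
    then have "C \<inter> S \<subseteq> M \<or> C - S \<subseteq> M" unfolding M_def by blast
    with C N(2) show "\<exists>C\<in>\<B>. C \<subseteq> B \<and> (C \<inter> S \<subseteq> (\<Union>n. N n) \<or> C - S \<subseteq> (\<Union>n. N n))"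
      by (meson subset_trans)
  qed (rule N)
qed

end

section \<open>Truncations and boxes\<close>

text \<open>A node of level \<open>n\<close> is represented by a point of the Cantor set, padded
  with \<open>False\<close>, so that maps defined on points can be applied to nodes.\<close>

definition trunc :: "nat \<Rightarrow> cantor \<Rightarrow> cantor" where
  "trunc n x = (\<lambda>i. i < n \<and> x i)"

lemma trunc_eq_iff: "trunc n x = trunc n y \<longleftrightarrow> (\<forall>i<n. x i = y i)"
  by (auto simp: trunc_def fun_eq_iff)

lemma trunc_trunc [simp]: "trunc n (trunc m x) = trunc (min n m) x"
  by (auto simp: trunc_def fun_eq_iff)

lemma trunc_eq_mono: "trunc m x = trunc m y \<Longrightarrow> n \<le> m \<Longrightarrow> trunc n x = trunc n y"
  by (auto simp: trunc_eq_iff)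

lemma finite_range_trunc: "finite (range (trunc n))"
proof -
  have "trunc n x \<in> (\<lambda>A i. i \<in> A) ` Pow {..<n}" for x
    by (rule image_eqI[of _ _ "{i. i < n \<and> x i}"]) (auto simp: trunc_def)
  then have "range (trunc n) \<subseteq> (\<lambda>A i. i \<in> A) ` Pow {..<n}" by blast
  then show ?thesis by (rule finite_subset) simp
qed

lemma open_cylinder: "open {y. trunc n y = trunc n x}"
proof -
  have "open (Pi\<^sub>E UNIV (\<lambda>i. if i < n then {x i} else UNIV))"
    by (rule open_PiE) (auto intro: finite_subset[of _ "{..<n}"] open_discrete)
  moreover have "Pi\<^sub>E UNIV (\<lambda>i. if i < n then {x i} else UNIV) = {y. trunc n y = trunc n x}"
    by (auto simp: trunc_eq_iff PiE_def Pi_def)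
  ultimately show ?thesis by simp
qed

text \<open>The \<open>eventually\<close> form lets finitely many such depths be merged into
  one.\<close>

lemma cylinder_subset_open:
  assumes "open U" "x \<in> U"
  shows "\<forall>\<^sub>F n in sequentially. \<forall>y. trunc n y = trunc n x \<longrightarrow> y \<in> U"
proof -
  obtain X where X: "x \<in> Pi\<^sub>E UNIV X" "finite {i. X i \<noteq> UNIV}" "Pi\<^sub>E UNIV X \<subseteq> U"
    using product_topology_open_contains_basis[of "\<lambda>_. euclidean" UNIV U x] assms
    by (auto simp: open_fun_def)
  obtain n where n: "\<And>i. X i \<noteq> UNIV \<Longrightarrow> i < n"
    using finite_nat_set_iff_bounded[of "{i. X i \<noteq> UNIV}"] X(2) by blast
  have "y \<in> U" if "m \<ge> n" "trunc m y = trunc m x" for m y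
  proof -
    have "y i \<in> X i" for i
    proof (cases "X i = UNIV")
      case False
      then have "y i = x i" using that n[of i] by (simp add: trunc_eq_iff)
      then show ?thesis using X(1) by (auto simp: PiE_iff)
    qed simp
    then show ?thesis using X(3) by (auto simp: PiE_iff)
  qed
  then show ?thesis unfolding eventually_sequentially by blast
qed

lemma trunc_neq_eventually:
  assumes "x \<noteq> y"
  shows "\<forall>\<^sub>F n in sequentially. trunc n x \<noteq> trunc n y"
proof -
  obtain i where i: "x i \<noteq> y i" using assms by blast
  then have "trunc n x \<noteq> trunc n y" if "n \<ge> Suc i" for n
    using that unfolding trunc_eq_iff by (metis Suc_le_lessD)
  then show ?thesis unfolding eventually_sequentially by blast
qed

lemma inj_on_trunc_eventually:
  assumes "finite A"
  shows "\<forall>\<^sub>F n in sequentially. inj_on (trunc n) A"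
proof -
  have "\<forall>\<^sub>F n in sequentially. \<forall>x\<in>A. \<forall>y\<in>A. trunc n x = trunc n y \<longrightarrow> x = y"
  proof (intro eventually_ball_finite assms ballI)
    fix x y
    show "\<forall>\<^sub>F n in sequentially. trunc n x = trunc n y \<longrightarrow> x = y"
      by (cases "x = y") (auto intro: eventually_mono[OF trunc_neq_eventually])
  qed
  then show ?thesis unfolding inj_on_def .
qed

lemma less_fun_eventually:
  assumes "less_fun x y"
  shows "\<forall>\<^sub>F n in sequentially. \<forall>x' y'. trunc n x' = trunc n x \<and> trunc n y' = trunc n y \<longrightarrow>
    less_fun x' y'"
proof -
  obtain i where "x i < y i" "\<forall>j<i. x j = y j" using assms by (auto simp: less_fun_def)
  then have "less_fun x' y'" if "n \<ge> Suc i" "trunc n x' = trunc n x" "trunc n y' = trunc n y"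
    for n x' y'
    unfolding less_fun_def using that by (intro exI[of _ i]) (auto simp: trunc_eq_iff)
  then show ?thesis unfolding eventually_sequentially by blast
qed

lemma compact_UNIV_cantor: "compact (UNIV :: cantor set)"
proof -
  have "compact_space (euclidean :: bool topology)"
    by (simp add: compact_space_def compactin_euclidean_iff finite_imp_compact)
  then have "compact_space (euclidean :: cantor topology)"
    by (simp flip: euclidean_product_topology add: compact_space_product_topology)
  then show ?thesis
    by (simp add: compact_space_def compactin_euclidean_iff)
qed

text \<open>Tuples of length \<open>k\<close> are infinite sequences of which only the first \<open>k\<close> entries
  count, so that the boxes for all \<open>k\<close> live on one type.\<close>

definition tuple_box :: "cantor set \<Rightarrow> nat \<Rightarrow> nat \<Rightarrow> (nat \<Rightarrow> cantor) \<Rightarrow> (nat \<Rightarrow> cantor) set" where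
  "tuple_box P k m s = {t. \<forall>i<k. t i \<in> P \<and> trunc m (t i) = trunc m (s i)}"

definition tuple_boxes :: "cantor set \<Rightarrow> nat \<Rightarrow> (nat \<Rightarrow> cantor) set set" where
  "tuple_boxes P k = {tuple_box P k m s | m s. \<forall>i<k. s i \<in> P}"

lemma tuple_box_subset:
  assumes "t \<in> tuple_box P k m s" "m \<le> n"
  shows "tuple_box P k n t \<subseteq> tuple_box P k m s"
proof
  fix u assume "u \<in> tuple_box P k n t"
  then have "u i \<in> P \<and> trunc m (u i) = trunc m (t i)" if "i < k" for i
    using that assms(2) trunc_eq_mono unfolding tuple_box_def by blast
  with assms(1) show "u \<in> tuple_box P k m s" by (simp add: tuple_box_def)
qed

lemma tuple_boxes_refine:
  assumes "B \<in> tuple_boxes P k" "t \<in> B"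
  shows "\<forall>\<^sub>F n in sequentially. t \<in> tuple_box P k n t \<and> tuple_box P k n t \<in> tuple_boxes P k \<and> tuple_box P k n t \<subseteq> B"
proof -
  obtain m s where B: "B = tuple_box P k m s" using assms(1) unfolding tuple_boxes_def by blast
  have P: "\<forall>i<k. t i \<in> P" using assms(2) unfolding B tuple_box_def by blast
  have "t \<in> tuple_box P k n t \<and> tuple_box P k n t \<in> tuple_boxes P k \<and> tuple_box P k n t \<subseteq> B" if "n \<ge> m" for n
  proof (intro conjI)
    show "t \<in> tuple_box P k n t" using P by (simp add: tuple_box_def)
    show "tuple_box P k n t \<in> tuple_boxes P k" using P unfolding tuple_boxes_def by blast
    show "tuple_box P k n t \<subseteq> B" using tuple_box_subset assms(2) that unfolding B by blast
  qed
  then show ?thesis unfolding eventually_sequentially by blast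
qed

lemma countable_tuple_boxes: "countable (tuple_boxes P k)"
proof -
  define F :: "nat \<times> bool list list \<Rightarrow> (nat \<Rightarrow> cantor) set" where
    "F = (\<lambda>(m, l). {t. \<forall>i<k. t i \<in> P \<and> (\<forall>j<m. t i j = l ! i ! j)})"
  have "tuple_box P k m s = F (m, map (\<lambda>i. map (s i) [0..<m]) [0..<k])" for m s
    unfolding tuple_box_def F_def by (simp add: trunc_eq_iff)
  then have "tuple_boxes P k \<subseteq> range F" unfolding tuple_boxes_def by blast
  then show ?thesis by (rule countable_subset) (intro countable_image countableI_type)
qed

interpretation boxes: category_base "tuple_boxes P k" for P k
proof
  fix B C t assume "B \<in> tuple_boxes P k" "C \<in> tuple_boxes P k" "t \<in> B" "t \<in> C"
  then have "\<forall>\<^sub>F n in sequentially. t \<in> tuple_box P k n t \<and> tuple_box P k n t \<in> tuple_boxes P k \<and>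
      tuple_box P k n t \<subseteq> B \<inter> C"
    using eventually_conj[OF tuple_boxes_refine[of B P k t] tuple_boxes_refine[of C P k t]]
    by (auto elim: eventually_mono)
  then show "\<exists>D\<in>tuple_boxes P k. t \<in> D \<and> D \<subseteq> B \<inter> C"
    unfolding eventually_sequentially by blast
qed (rule countable_tuple_boxes)

section \<open>\<open>C\<close>-measurable families of finite sets have the Baire property\<close>

definition tuples :: "nat \<Rightarrow> cantor set set \<Rightarrow> (nat \<Rightarrow> cantor) set" where
  "tuples k \<F> = {s. inj_on s {..<k} \<and> s ` {..<k} \<in> \<F>}"

lemma tuples_open:
  assumes U: "openin finsets_topology U" and s: "s \<in> tuples k U"
  shows "\<forall>\<^sub>F m in sequentially. \<forall>t. (\<forall>i<k. trunc m (t i) = trunc m (s i)) \<longrightarrow> t \<in> tuples k U"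
proof -
  have inj: "inj_on s {..<k}" and sU: "s ` {..<k} \<in> U" using s by (auto simp: tuples_def)
  then have card: "card (s ` {..<k}) = k" by (simp add: card_image)
  have k: "k \<ge> 1"
    using sU openin_subset[OF U] by (auto simp: finsets_eq Suc_le_eq)
  define r where "r = incr_enum (s ` {..<k})"
  have r: "r \<in> incr_seqs k" "r ` {..<k} = s ` {..<k}"
    using incr_enum[of "s ` {..<k}"] by (simp_all add: card r_def)
  \<comment> \<open>The topology reads the set in its increasing order \<open>r\<close>, while
    \<open>s\<close> lists it in any order; \<open>\<pi>\<close> is the permutation that sorts
    \<open>s\<close>.\<close>
  have "\<forall>i\<in>{..<k}. \<exists>j\<in>{..<k}. r i = s j" using r(2) by blast
  then obtain \<pi> where \<pi>: "\<And>i. i < k \<Longrightarrow> \<pi> i < k" "\<And>i. i < k \<Longrightarrow> r i = s (\<pi> i)"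
    by (metis lessThan_iff)
  have "inj_on r {..<k}" by (rule eq_card_imp_inj_on) (simp_all add: r(2) card)
  then have "inj_on \<pi> {..<k}" unfolding inj_on_def by (metis \<pi>(2) lessThan_iff)
  then have \<pi>_surj: "\<pi> ` {..<k} = {..<k}"
    by (intro endo_inj_surj) (use \<pi>(1) in auto)
  obtain V where V: "openin (sum_topology incr_seq_topology {1..}) V"
    "U = (\<lambda>F. (card F, incr_enum F)) -` V \<inter> finsets UNIV"
    using U unfolding finsets_topology_def openin_pullback_topology by blast
  have "openin (incr_seq_topology k) {x. (k, x) \<in> V}"
    using V(1) k by (simp add: openin_sum_topology)
  then obtain W where W: "openin (product_topology (\<lambda>_. euclidean) {..<k}) W"
    "{x. (k, x) \<in> V} = W \<inter> incr_seqs k"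
    unfolding incr_seq_topology_def openin_subtopology by blast
  have "r \<in> W" using sU W(2) unfolding V(2) by (auto simp: r_def card)
  from product_topology_open_contains_basis[OF W(1) this]
  obtain X where X: "r \<in> Pi\<^sub>E {..<k} X" "\<And>i. open (X i)" "Pi\<^sub>E {..<k} X \<subseteq> W"
    by auto
  have 1: "\<forall>\<^sub>F m in sequentially. \<forall>i\<in>{..<k}. \<forall>y. trunc m y = trunc m (r i) \<longrightarrow> y \<in> X i"
    by (intro eventually_ball_finite ballI cylinder_subset_open) (use X in auto)
  \<comment> \<open>Sorting is stable: a tuple close enough to \<open>s\<close> is put in increasing
    order by the same \<open>\<pi>\<close>.\<close>
  have 2: "\<forall>\<^sub>F m in sequentially. \<forall>p\<in>{(i, j). i < j \<and> j < k}. \<forall>x y.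
      trunc m x = trunc m (r (fst p)) \<and> trunc m y = trunc m (r (snd p)) \<longrightarrow> less_fun x y"
  proof (intro eventually_ball_finite ballI less_fun_eventually)
    show "finite {(i, j). i < j \<and> j < k}"
      by (rule finite_subset[of _ "{..<k} \<times> {..<k}"]) auto
  qed (use r(1) in \<open>auto simp: incr_seqs_def\<close>)
  from eventually_conj[OF 1 2] show ?thesis
  proof (rule eventually_mono, intro allI impI)
    fix m t
    assume m: "(\<forall>i\<in>{..<k}. \<forall>y. trunc m y = trunc m (r i) \<longrightarrow> y \<in> X i) \<and>
      (\<forall>p\<in>{(i, j). i < j \<and> j < k}. \<forall>x y.
        trunc m x = trunc m (r (fst p)) \<and> trunc m y = trunc m (r (snd p)) \<longrightarrow> less_fun x y)"
      and t: "\<forall>i<k. trunc m (t i) = trunc m (s i)"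
    define r' where "r' = restrict (t \<circ> \<pi>) {..<k}"
    have tr: "trunc m (r' i) = trunc m (r i)" if "i < k" for i
      using that t \<pi> by (simp add: r'_def)
    have r'_X: "r' \<in> Pi\<^sub>E {..<k} X"
      using m tr by (auto simp: PiE_iff r'_def)
    have "less_fun (r' i) (r' j)" if "i < j" "j < k" for i j
    proof -
      have "trunc m (r' i) = trunc m (r i)" "trunc m (r' j) = trunc m (r j)"
        using tr that by simp_all
      then show ?thesis using m that by fastforce
    qed
    then have r'_incr: "r' \<in> incr_seqs k"
      unfolding incr_seqs_def by (simp add: r'_def)
    have "r' ` {..<k} = t ` \<pi> ` {..<k}"
      unfolding r'_def by (simp add: image_comp)
    then have im: "r' ` {..<k} = t ` {..<k}" by (simp only: \<pi>_surj)
    have "(k, r') \<in> V" using r'_X X(3) r'_incr W(2) by blast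
    then have "(card (t ` {..<k}), incr_enum (t ` {..<k})) \<in> V"
      using incr_enum_image[OF r'_incr] by (simp add: im)
    then have "t ` {..<k} \<in> U"
      unfolding V(2) using k by (auto simp: finsets_eq lessThan_empty_iff)
    moreover have "inj_on t {..<k}"
      by (rule eq_card_imp_inj_on) (use incr_enum_image[OF r'_incr] im in simp_all)
    ultimately show "t \<in> tuples k U" by (simp add: tuples_def)
  qed
qed

text \<open>The sets with this property form a sigma-algebra that contains the open sets and is
  closed under the Souslin operation, since \<open>tuples k\<close> commutes with unions,
  differences and \<open>souslin\<close>.\<close>

lemma baire_tuples:
  assumes "C_measurable_in finsets_topology \<F>"
  shows "boxes.baire P k (tuples k \<F>)"
proof -
  define M where "M = {S. S \<subseteq> finsets UNIV \<and> boxes.baire P k (tuples k S)}"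
  have op: "U \<in> M" if U: "openin finsets_topology U" for U
  proof -
    have "boxes.baire P k (tuples k U)"
    proof (rule boxes.baire_open)
      fix t B assume t: "t \<in> tuples k U" "B \<in> tuple_boxes P k" "t \<in> B"
      from eventually_conj[OF tuples_open[OF U t(1)] tuple_boxes_refine[OF t(2,3)]]
      obtain m where m: "\<forall>u. (\<forall>i<k. trunc m (u i) = trunc m (t i)) \<longrightarrow> u \<in> tuples k U"
        "t \<in> tuple_box P k m t" "tuple_box P k m t \<in> tuple_boxes P k"
        unfolding eventually_sequentially by blast
      then show "\<exists>C\<in>tuple_boxes P k. t \<in> C \<and> C \<subseteq> tuples k U"
        by (intro bexI[of _ "tuple_box P k m t"]) (auto simp: tuple_box_def)
    qed
    with openin_subset[OF U] show ?thesis by (simp add: M_def)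
  qed
  have "sigma_algebra (topspace finsets_topology) M"
    unfolding sigma_algebra_iff2 topspace_finsets_topology
  proof (intro conjI ballI allI impI)
    show "M \<subseteq> Pow (finsets UNIV)" by (auto simp: M_def)
    show "{} \<in> M" by (rule op) simp
  next
    fix S assume "S \<in> M"
    moreover have "finsets UNIV \<in> M"
      using op[OF openin_topspace] by simp
    ultimately have "boxes.baire P k (tuples k (finsets UNIV) - tuples k S)"
      unfolding M_def by (intro boxes.baire_Diff) auto
    moreover have "tuples k (finsets UNIV) - tuples k S = tuples k (finsets UNIV - S)"
      by (auto simp: tuples_def)
    ultimately show "finsets UNIV - S \<in> M" by (simp add: M_def)
  next
    fix A :: "nat \<Rightarrow> cantor set set" assume A: "range A \<subseteq> M"
    then have "boxes.baire P k (\<Union>n. tuples k (A n))"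
      by (intro boxes.baire_UN) (auto simp: M_def)
    moreover have "(\<Union>n. tuples k (A n)) = tuples k (\<Union>n. A n)"
      by (auto simp: tuples_def)
    ultimately show "(\<Union>n. A n) \<in> M" using A by (auto simp: M_def)
  qed
  moreover have "souslin A \<in> M" if A: "range A \<subseteq> M" for A
  proof -
    have "boxes.baire P k (souslin (\<lambda>l. tuples k (A l)))"
      by (intro boxes.baire_souslin) (use A in \<open>auto simp: M_def\<close>)
    moreover have "souslin (\<lambda>l. tuples k (A l)) = tuples k (souslin A)"
      unfolding souslin_def tuples_def by blast
    moreover have "souslin A \<subseteq> finsets UNIV"
      using A unfolding souslin_def M_def by blast
    ultimately show ?thesis by (simp add: M_def)
  qed
  ultimately have "C_sets finsets_topology \<subseteq> M"
    unfolding C_sets_def using op by (intro Inter_lower) blast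
  with assms show ?thesis by (auto simp: C_measurable_in_def M_def)
qed

section \<open>The fusion\<close>

lemma tuple_box_cong:
  "(\<And>i. i < k \<Longrightarrow> trunc m (s i) = trunc m (t i)) \<Longrightarrow> tuple_box P k m s = tuple_box P k m t"
  by (auto simp: tuple_box_def)

text \<open>The tuples in \<open>R\<close> are treated one after another. Density gives a smaller
  box for the current tuple, and its points move there within their old cylinders; earlier tuples
  end up in subboxes, so heredity of \<open>D\<close> keeps what was achieved.\<close>

lemma refine_tuples:
  assumes dense: "\<forall>k. \<forall>B\<in>tuple_boxes P k. \<exists>C\<in>tuple_boxes P k. C \<subseteq> B \<and> D k C"
    and hered: "\<forall>k B C. D k B \<longrightarrow> C \<subseteq> B \<longrightarrow> D k C"
    and R: "finite R" "\<forall>(k, s)\<in>R. s ` {..<k} \<subseteq> T \<and> inj_on s {..<k}"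
    and f: "f ` T \<subseteq> P"
  shows "\<exists>g n. m \<le> n \<and> g ` T \<subseteq> P \<and> (\<forall>x\<in>T. trunc m (g x) = trunc m (f x)) \<and>
    (\<forall>(k, s)\<in>R. D k (tuple_box P k n (g \<circ> s)))"
  using R
proof (induction R rule: finite_induct)
  case empty
  show ?case using f by (intro exI[of _ f] exI[of _ m]) auto
next
  case (insert p R)
  from insert.prems have "\<forall>(k, s)\<in>R. s ` {..<k} \<subseteq> T \<and> inj_on s {..<k}" by simp
  from insert.IH[OF this] obtain g n where g: "m \<le> n" "g ` T \<subseteq> P" "\<forall>x\<in>T. trunc m (g x) = trunc m (f x)"
    "\<forall>(k, s)\<in>R. D k (tuple_box P k n (g \<circ> s))"
    by blast
  obtain k s where p: "p = (k, s)" by fastforce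
  have s: "s ` {..<k} \<subseteq> T" "inj_on s {..<k}" using insert.prems p by auto
  have "tuple_box P k n (g \<circ> s) \<in> tuple_boxes P k"
    unfolding tuple_boxes_def using s(1) g(2) by fastforce
  with dense obtain C where "C \<in> tuple_boxes P k" "C \<subseteq> tuple_box P k n (g \<circ> s)" "D k C"
    by blast
  then obtain n' t where t: "\<forall>i<k. t i \<in> P"
    "tuple_box P k n' t \<subseteq> tuple_box P k n (g \<circ> s)" "D k (tuple_box P k n' t)"
    unfolding tuple_boxes_def by blast
  have "t \<in> tuple_box P k n' t" using t(1) by (simp add: tuple_box_def)
  with t(2) have t_g: "trunc n (t i) = trunc n (g (s i))" if "i < k" for i
    using that by (auto simp: tuple_box_def)
  \<comment> \<open>Only the nodes listed by \<open>s\<close> are moved; injectivity of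
    \<open>s\<close> makes their new position unambiguous.\<close>
  define h where "h x = (if x \<in> s ` {..<k} then t (inv_into {..<k} s x) else g x)" for x
  have h_s: "h (s i) = t i" if "i < k" for i
    using that s(2) by (simp add: h_def)
  have h_g: "trunc n (h x) = trunc n (g x)" for x
    unfolding h_def using t_g f_inv_into_f[of x s "{..<k}"] inv_into_into[of x s "{..<k}"] by auto
  define N where "N = max n n'"
  show ?case
  proof (intro exI conjI)
    show "m \<le> N" using g(1) by (simp add: N_def)
    show "h ` T \<subseteq> P"
    proof
      fix y assume "y \<in> h ` T"
      then obtain x where x: "x \<in> T" "y = h x" by blast
      show "y \<in> P"
      proof (cases "x \<in> s ` {..<k}")
        case True
        then show ?thesis using h_s t(1) x(2) by auto
      next
        case False
        then show ?thesis using x g(2) by (auto simp: h_def)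
      qed
    qed
    show "\<forall>x\<in>T. trunc m (h x) = trunc m (f x)"
      using g(3) trunc_eq_mono[OF h_g g(1)] by simp
    show "\<forall>(k, s)\<in>insert p R. D k (tuple_box P k N (h \<circ> s))"
    proof (clarify)
      fix l u assume lu: "(l, u) \<in> insert p R"
      show "D l (tuple_box P l N (h \<circ> u))"
      proof (cases "(l, u) = p")
        case True
        then have lu': "l = k" "u = s" by (simp_all add: p)
        have "h \<circ> s \<in> tuple_box P k n' t"
          using t(1) by (simp add: tuple_box_def h_s)
        then have "tuple_box P k N (h \<circ> s) \<subseteq> tuple_box P k n' t"
          by (rule tuple_box_subset) (simp add: N_def)
        then show ?thesis unfolding lu' using hered t(3) by blast
      next
        case False
        with lu g(4) have D: "D l (tuple_box P l n (g \<circ> u))" by blast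
        have "tuple_box P l N (h \<circ> u) \<subseteq> tuple_box P l n (g \<circ> u)"
        proof
          fix v assume "v \<in> tuple_box P l N (h \<circ> u)"
          then have "v i \<in> P \<and> trunc n (v i) = trunc n (h (u i))" if "i < l" for i
            using that trunc_eq_mono[of N "v i" "h (u i)" n] by (simp add: tuple_box_def N_def)
          then show "v \<in> tuple_box P l n (g \<circ> u)" by (simp add: tuple_box_def h_g)
        qed
        then show ?thesis using hered D by blast
      qed
    qed
  qed
qed

text \<open>Only finitely many injective tuples live on the finite \<open>T\<close>, so one stage
  can treat them all. Starting from a depth that separates the points placed by \<open>f\<close>
  keeps them separated.\<close>

lemma refine_inj:
  assumes dense: "\<forall>k. \<forall>B\<in>tuple_boxes P k. \<exists>C\<in>tuple_boxes P k. C \<subseteq> B \<and> D k C"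
    and hered: "\<forall>k B C. D k B \<longrightarrow> C \<subseteq> B \<longrightarrow> D k C"
    and T: "finite T" and f: "f ` T \<subseteq> P" "inj_on f T"
  shows "\<exists>g n. m \<le> n \<and> g ` T \<subseteq> P \<and> (\<forall>x\<in>T. trunc m (g x) = trunc m (f x)) \<and>
    inj_on (trunc n \<circ> g) T \<and>
    (\<forall>k s. s ` {..<k} \<subseteq> T \<longrightarrow> inj_on s {..<k} \<longrightarrow> D k (tuple_box P k n (g \<circ> s)))"
proof -
  obtain m' where m': "m' \<ge> m" "inj_on (trunc m') (f ` T)"
    using inj_on_trunc_eventually[of "f ` T"] T unfolding eventually_sequentially
    by (meson finite_imageI nle_le)
  \<comment> \<open>Injectivity bounds the length by \<open>card T\<close>, and extensional tuples
    make \<open>R\<close> finite; values from \<open>k\<close> on do not affect a box.\<close>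
  define R where "R = (SIGMA k:{..card T}. ({..<k} \<rightarrow>\<^sub>E T) \<inter> {s. inj_on s {..<k}})"
  have "finite R"
    unfolding R_def using T by (intro finite_SigmaI) (auto intro!: finite_Int finite_PiE)
  moreover have "\<forall>(k, s)\<in>R. s ` {..<k} \<subseteq> T \<and> inj_on s {..<k}"
    unfolding R_def by auto
  ultimately obtain g n where g: "m' \<le> n" "g ` T \<subseteq> P" "\<forall>x\<in>T. trunc m' (g x) = trunc m' (f x)"
    "\<forall>(k, s)\<in>R. D k (tuple_box P k n (g \<circ> s))"
    using refine_tuples[OF dense hered _ _ f(1), of R m'] by blast
  have "inj_on (trunc n \<circ> g) T"
  proof (rule inj_onI)
    fix x y assume xy: "x \<in> T" "y \<in> T" "(trunc n \<circ> g) x = (trunc n \<circ> g) y"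
    then have "trunc m' (f x) = trunc m' (f y)"
      using trunc_eq_mono[of n "g x" "g y" m'] g(1,3) by simp
    then show "x = y" using m'(2) f(2) xy(1,2) by (auto simp: inj_on_def)
  qed
  moreover have "D k (tuple_box P k n (g \<circ> s))" if s: "s ` {..<k} \<subseteq> T" "inj_on s {..<k}" for k s
  proof -
    have "k \<le> card T"
      using card_inj_on_le[OF s(2,1) T] by simp
    then have "(k, restrict s {..<k}) \<in> R"
      unfolding R_def using s by (auto simp: inj_on_def)
    with g(4) have "D k (tuple_box P k n (g \<circ> restrict s {..<k}))" by blast
    moreover have "tuple_box P k n (g \<circ> restrict s {..<k}) = tuple_box P k n (g \<circ> s)"
      by (rule tuple_box_cong) simp
    ultimately show ?thesis by simp
  qed
  moreover have "\<forall>x\<in>T. trunc m (g x) = trunc m (f x)"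
    using g(3) m'(1) trunc_eq_mono by blast
  ultimately show ?thesis using g(1,2) m'(1) by (intro exI[of _ g] exI[of _ n]) auto
qed

lemma perfect_split:
  assumes "perfect P" "x \<in> P"
  shows "\<exists>y\<in>P. y \<noteq> x \<and> trunc m y = trunc m x"
proof (rule ccontr)
  assume "\<not> ?thesis"
  then have "{y. trunc m y = trunc m x} \<inter> P = {x}" using assms(2) by auto
  then have "x isolated_in P"
    using isolated_inI[OF assms(2) open_cylinder[of m x]] by blast
  with assms(1) show False by (simp add: perfect_def)
qed

text \<open>The limit of stages in which the cylinder of a level-\<open>n\<close> node is sent into
  a box around the point placed for that node. The index \<open>n\<close> lets the demand
  \<open>D\<close> grow from stage to stage; density makes it attainable, heredity keeps it when
  boxes shrink.\<close>

lemma fusion: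
  assumes P: "perfect P"
    and dense: "\<forall>n k. \<forall>B\<in>tuple_boxes P k. \<exists>C\<in>tuple_boxes P k. C \<subseteq> B \<and> D n k C"
    and hered: "\<forall>n k B C. D n k B \<longrightarrow> C \<subseteq> B \<longrightarrow> D n k C"
  obtains e :: "cantor \<Rightarrow> cantor" where "inj e" "continuous_on UNIV e" "range e \<subseteq> P"
    "\<And>n k s. inj_on (trunc n \<circ> s) {..<k} \<Longrightarrow>
      \<exists>B. D n k B \<and> (\<forall>t. (\<forall>i<k. trunc n (t i) = trunc n (s i)) \<longrightarrow> e \<circ> t \<in> B)"
proof -
  define T where "T n = range (trunc n)" for n
  \<comment> \<open>At stage \<open>n\<close>, \<open>f\<close> places the nodes in \<open>P\<close>
    and \<open>m\<close> is the depth of the boxes around them. The bound \<open>n \<le> m\<close>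
    makes the boxes shrink to points; injectivity after truncation makes them disjoint, whence
    \<open>inj e\<close>.\<close>
  define I where "I = (\<lambda>n (f, m). n \<le> m \<and> f ` T n \<subseteq> P \<and> inj_on (trunc m \<circ> f) (T n) \<and>
    (\<forall>k s. s ` {..<k} \<subseteq> T n \<longrightarrow> inj_on s {..<k} \<longrightarrow> D n k (tuple_box P k m (f \<circ> s))))"
  define R where "R = (\<lambda>n (f, m) (g, m'). m \<le> m' \<and>
    (\<forall>x\<in>T (Suc n). trunc m (g x) = trunc m (f (trunc n x))))"
  have ext: "\<exists>g n'. I n (g, n') \<and> m \<le> n' \<and> (\<forall>x\<in>T n. trunc m (g x) = trunc m (f x))"
    if "f ` T n \<subseteq> P" "inj_on f (T n)" for f n m
  proof -
    have "\<forall>k. \<forall>B\<in>tuple_boxes P k. \<exists>C\<in>tuple_boxes P k. C \<subseteq> B \<and> D n k C"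
      "\<forall>k B C. D n k B \<longrightarrow> C \<subseteq> B \<longrightarrow> D n k C"
      using dense hered by blast+
    from refine_inj[OF this _ that, of "max m n"]
    obtain g n' where g: "max m n \<le> n'" "g ` T n \<subseteq> P"
      "\<forall>x\<in>T n. trunc (max m n) (g x) = trunc (max m n) (f x)" "inj_on (trunc n' \<circ> g) (T n)"
      "\<forall>k s. s ` {..<k} \<subseteq> T n \<longrightarrow> inj_on s {..<k} \<longrightarrow> D n k (tuple_box P k n' (g \<circ> s))"
      using finite_range_trunc[of n] unfolding T_def by blast
    then have "I n (g, n')" by (simp add: I_def)
    moreover have "\<forall>x\<in>T n. trunc m (g x) = trunc m (f x)"
      using g(3) trunc_eq_mono by (metis max.cobounded1)
    ultimately show ?thesis using g(1) by (intro exI[of _ g] exI[of _ n']) simp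
  qed
  have "\<exists>F. \<forall>n. I n (F n) \<and> R n (F n) (F (Suc n))"
  proof (rule dependent_nat_choice)
    obtain p where "p \<in> P" using P unfolding perfect_def by blast
    moreover have "T 0 = {\<lambda>_. False}" by (auto simp: T_def trunc_def)
    ultimately show "\<exists>x. I 0 x" using ext[of "\<lambda>_. p" 0 0] by auto
  next
    fix x n assume "I n x"
    then obtain f m where x: "x = (f, m)" and fm: "n \<le> m" "f ` T n \<subseteq> P" "inj_on (trunc m \<circ> f) (T n)"
      unfolding I_def by auto
    have "\<forall>z\<in>T n. \<exists>y\<in>P. y \<noteq> f z \<and> trunc m y = trunc m (f z)"
      using perfect_split[OF P] fm(2) by blast
    then obtain y where y: "\<And>z. z \<in> T n \<Longrightarrow> y z \<in> P \<and> y z \<noteq> f z \<and> trunc m (y z) = trunc m (f z)"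
      by metis
    \<comment> \<open>Splitting: the child with bit \<open>False\<close> stays at its parent's
      point, the other one goes to a second point of \<open>P\<close> in the same box.\<close>
    define g where "g x = (if x n then y (trunc n x) else f (trunc n x))" for x
    have tr: "trunc n x \<in> T n" for x by (simp add: T_def)
    have g_f: "trunc m (g x) = trunc m (f (trunc n x))" for x
      using y[OF tr] by (simp add: g_def)
    have "inj_on g (T (Suc n))"
    proof (rule inj_onI)
      fix u v assume uv: "u \<in> T (Suc n)" "v \<in> T (Suc n)" "g u = g v"
      then have "trunc m (f (trunc n u)) = trunc m (f (trunc n v))"
        using g_f by metis
      then have eq: "trunc n u = trunc n v"
        using inj_onD[OF fm(3), of "trunc n u" "trunc n v"] tr by simp
      have "u n = v n"
        using uv(3) y[OF tr, of v] eq unfolding g_def by (auto split: if_splits)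
      with eq have "trunc (Suc n) u = trunc (Suc n) v"
        by (auto simp: trunc_eq_iff less_Suc_eq)
      with uv(1,2) show "u = v" by (auto simp: T_def)
    qed
    moreover have "g ` T (Suc n) \<subseteq> P"
      using y tr fm(2) unfolding g_def by auto
    ultimately obtain h n' where h: "I (Suc n) (h, n')" "m \<le> n'"
      "\<forall>x\<in>T (Suc n). trunc m (h x) = trunc m (g x)"
      using ext[of g "Suc n" m] by blast
    then have "R n x (h, n')" by (simp add: R_def x g_f)
    with h(1) show "\<exists>y. I (Suc n) y \<and> R n x y" by blast
  qed
  then obtain F where F: "\<And>n. I n (F n)" "\<And>n. R n (F n) (F (Suc n))" by blast
  define f where "f n = fst (F n)" for n
  define m where "m n = snd (F n)" for n
  have F_eq: "F n = (f n, m n)" for n by (simp add: f_def m_def)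
  have m_ge: "n \<le> m n" and f_P: "f n ` T n \<subseteq> P" and f_inj: "inj_on (trunc (m n) \<circ> f n) (T n)"
    and f_D: "\<And>k s. s ` {..<k} \<subseteq> T n \<Longrightarrow> inj_on s {..<k} \<Longrightarrow> D n k (tuple_box P k (m n) (f n \<circ> s))"
    for n
    using F(1)[of n] unfolding F_eq I_def by auto
  have m_Suc: "m n \<le> m (Suc n)"
    and f_Suc: "\<And>x. x \<in> T (Suc n) \<Longrightarrow> trunc (m n) (f (Suc n) x) = trunc (m n) (f n (trunc n x))"
    for n
    using F(2)[of n] unfolding F_eq R_def by auto
  have tr: "trunc n x \<in> T n" for n x by (simp add: T_def)
  have m_mono: "m i \<le> m j" if "i \<le> j" for i j
    using lift_Suc_mono_le[of m, OF m_Suc that] .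
  have coh: "trunc (m n) (f n' (trunc n' x)) = trunc (m n) (f n (trunc n x))" if "n \<le> n'" for n n' x
    using that
  proof (induction n' rule: dec_induct)
    case (step i)
    have "trunc (m i) (f (Suc i) (trunc (Suc i) x)) = trunc (m i) (f i (trunc i x))"
      using f_Suc[OF tr] by simp
    from trunc_eq_mono[OF this m_mono[OF step.hyps(1)]] step.IH show ?case by simp
  qed simp
  \<comment> \<open>Bit \<open>j\<close> is final from stage \<open>Suc j\<close> on, which fixes
    \<open>m (Suc j) \<ge> Suc j\<close> bits.\<close>
  define e where "e x = (\<lambda>j. f (Suc j) (trunc (Suc j) x) j)" for x
  have e: "trunc (m n) (e x) = trunc (m n) (f n (trunc n x))" for n x
    unfolding trunc_eq_iff
  proof (intro allI impI)
    fix j assume j: "j < m n"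
    show "e x j = f n (trunc n x) j"
    proof (cases "n \<le> Suc j")
      case True
      then show ?thesis using coh[OF True, of x] j by (simp add: trunc_eq_iff e_def)
    next
      case False
      then have "trunc (m (Suc j)) (f n (trunc n x)) = trunc (m (Suc j)) (f (Suc j) (trunc (Suc j) x))"
        by (intro coh) simp
      moreover have "j < m (Suc j)" using m_ge[of "Suc j"] by simp
      ultimately show ?thesis by (simp add: trunc_eq_iff e_def)
    qed
  qed
  have e_P: "e x \<in> P" for x
  proof (rule ccontr)
    assume "e x \<notin> P"
    moreover have "open (- P)" using P by (simp add: perfect_def open_Compl)
    ultimately obtain n where n: "\<forall>k\<ge>n. \<forall>y. trunc k y = trunc k (e x) \<longrightarrow> y \<in> - P"
      using cylinder_subset_open[of "- P" "e x"] unfolding eventually_sequentially by blast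
    have "f n (trunc n x) \<in> - P"
      using n m_ge[of n] e[of n x] by metis
    then show False using f_P[of n] tr by blast
  qed
  show ?thesis
  proof (rule that)
    show "inj e"
    proof (rule injI)
      fix x y assume "e x = e y"
      then have "trunc (m n) (f n (trunc n x)) = trunc (m n) (f n (trunc n y))" for n
        using e by metis
      then have eq: "trunc n x = trunc n y" for n
        using inj_onD[OF f_inj[of n], of "trunc n x" "trunc n y"] tr by simp
      have "x i = y i" for i
        using eq[of "Suc i"] by (simp add: trunc_eq_iff)
      then show "x = y" by blast
    qed
    show "continuous_on UNIV e"
      unfolding continuous_on_open_vimage[OF open_UNIV]
    proof (intro allI impI)
      fix U :: "cantor set" assume U: "open U"
      have "\<exists>V. open V \<and> x \<in> V \<and> V \<subseteq> e -` U" if "x \<in> e -` U" for x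
      proof -
        have "e x \<in> U" using that by simp
        from cylinder_subset_open[OF U this]
        obtain n where n: "\<forall>k\<ge>n. \<forall>y. trunc k y = trunc k (e x) \<longrightarrow> y \<in> U"
          unfolding eventually_sequentially by blast
        have "e y \<in> U" if "trunc n y = trunc n x" for y
          using n m_ge[of n] e[of n x] e[of n y] that by metis
        then show ?thesis
          using open_cylinder[of n x] by (intro exI[of _ "{y. trunc n y = trunc n x}"]) auto
      qed
      then have "open (e -` U)" by (subst open_subopen) blast
      then show "open (e -` U \<inter> UNIV)" by simp
    qed
    show "range e \<subseteq> P" using e_P by blast
    fix n k and s :: "nat \<Rightarrow> cantor" assume s: "inj_on (trunc n \<circ> s) {..<k}"
    have "e \<circ> t \<in> tuple_box P k (m n) (f n \<circ> (trunc n \<circ> s))"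
      if "\<forall>i<k. trunc n (t i) = trunc n (s i)" for t
      using that e_P e by (simp add: tuple_box_def)
    moreover have "D n k (tuple_box P k (m n) (f n \<circ> (trunc n \<circ> s)))"
      by (rule f_D[OF _ s]) (auto simp: T_def)
    ultimately show "\<exists>B. D n k B \<and> (\<forall>t. (\<forall>i<k. trunc n (t i) = trunc n (s i)) \<longrightarrow> e \<circ> t \<in> B)"
      by blast
  qed
qed

lemma homogeneous_embedding:
  assumes P: "perfect P" and \<F>: "C_measurable_in finsets_topology \<F>"
  obtains e :: "cantor \<Rightarrow> cantor" where "inj e" "continuous_on UNIV e" "range e \<subseteq> P"
    "\<And>n A B. finite A \<Longrightarrow> finite B \<Longrightarrow> inj_on (trunc n) A \<Longrightarrow> inj_on (trunc n) B \<Longrightarrow>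
      trunc n ` A = trunc n ` B \<Longrightarrow> e ` A \<in> \<F> \<longleftrightarrow> e ` B \<in> \<F>"
proof -
  have "\<exists>N. (\<forall>j. boxes.nowhere_dense P k (N j)) \<and> (\<forall>B\<in>tuple_boxes P k. \<exists>C\<in>tuple_boxes P k.
      C \<subseteq> B \<and> (C \<inter> tuples k \<F> \<subseteq> (\<Union>j::nat. N j) \<or> C - tuples k \<F> \<subseteq> (\<Union>j. N j)))" for k
    using boxes.baire_decided[OF baire_tuples[OF \<F>, of P k]] by metis
  then obtain N :: "nat \<Rightarrow> nat \<Rightarrow> (nat \<Rightarrow> cantor) set" where
    N: "\<And>k j. boxes.nowhere_dense P k (N k j)"
    and decided: "\<And>k B. B \<in> tuple_boxes P k \<Longrightarrow> \<exists>C\<in>tuple_boxes P k.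
      C \<subseteq> B \<and> (C \<inter> tuples k \<F> \<subseteq> (\<Union>j. N k j) \<or> C - tuples k \<F> \<subseteq> (\<Union>j. N k j))"
    by metis
  \<comment> \<open>The first part makes \<open>B\<close> homogeneous up to the meager set for
    \<open>k\<close>. The second spreads the removal of that set over the stages, one more nowhere
    dense piece at each.\<close>
  define D where "D n k B \<longleftrightarrow> (B \<inter> tuples k \<F> \<subseteq> (\<Union>j. N k j) \<or> B - tuples k \<F> \<subseteq> (\<Union>j. N k j)) \<and>
    (\<forall>j<n. B \<inter> N k j = {})" for n k B
  have hered: "\<forall>n k B C. D n k B \<longrightarrow> C \<subseteq> B \<longrightarrow> D n k C"
    unfolding D_def by blast
  have dense: "\<exists>C\<in>tuple_boxes P k. C \<subseteq> B \<and> D n k C" if B: "B \<in> tuple_boxes P k" for n k B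
  proof (induction n)
    case 0
    show ?case using decided[OF B] by (simp add: D_def)
  next
    case (Suc n)
    then obtain C where C: "C \<in> tuple_boxes P k" "C \<subseteq> B" "D n k C" by blast
    then obtain E where E: "E \<in> tuple_boxes P k" "E \<subseteq> C" "E \<inter> N k n = {}"
      using N[of k n] unfolding boxes.nowhere_dense_def by blast
    have "D n k E" using hered C(3) E(2) by blast
    then have "D (Suc n) k E"
      using E(3) unfolding D_def less_Suc_eq by blast
    with C E show ?case by blast
  qed
  then have "\<forall>n k. \<forall>B\<in>tuple_boxes P k. \<exists>C\<in>tuple_boxes P k. C \<subseteq> B \<and> D n k C"
    by blast
  from fusion[OF P this hered]
  obtain e :: "cantor \<Rightarrow> cantor" where e: "inj e" "continuous_on UNIV e" "range e \<subseteq> P"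
    and eD: "\<And>n k s. inj_on (trunc n \<circ> s) {..<k} \<Longrightarrow>
      \<exists>B. D n k B \<and> (\<forall>t. (\<forall>i<k. trunc n (t i) = trunc n (s i)) \<longrightarrow> e \<circ> t \<in> B)"
    by blast
  \<comment> \<open>A set that is separated at level \<open>n\<close> is so at all higher levels; hence its image
    lies in sets avoiding every \<open>N k j\<close>.\<close>
  have avoid: "e \<circ> s \<notin> N k j" if s: "inj_on (trunc n \<circ> s) {..<k}" for n k s j
  proof -
    define n' where "n' = max n (Suc j)"
    have "inj_on (trunc n' \<circ> s) {..<k}"
    proof (rule inj_onI)
      fix i l assume il: "i \<in> {..<k}" "l \<in> {..<k}" "(trunc n' \<circ> s) i = (trunc n' \<circ> s) l"
      then have "trunc n (s i) = trunc n (s l)"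
        using trunc_eq_mono[of n' "s i" "s l" n] by (simp add: n'_def)
      then show "i = l" using inj_onD[OF s _ il(1,2)] by simp
    qed
    from eD[OF this] obtain B where "D n' k B" "e \<circ> s \<in> B" by blast
    moreover have "j < n'" by (simp add: n'_def)
    ultimately show ?thesis unfolding D_def by blast
  qed
  \<comment> \<open>Both tuples lie in one box, decided off a meager set that both avoid.\<close>
  have hom: "e \<circ> s \<in> tuples k \<F> \<longleftrightarrow> e \<circ> t \<in> tuples k \<F>"
    if s: "inj_on (trunc n \<circ> s) {..<k}" and st: "\<forall>i<k. trunc n (t i) = trunc n (s i)" for n k s t
  proof -
    have t: "inj_on (trunc n \<circ> t) {..<k}"
      using s st by (simp add: inj_on_def)
    from eD[OF s] obtain B where B: "D n k B" "e \<circ> s \<in> B" "e \<circ> t \<in> B" using st by blast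
    with avoid[OF s] avoid[OF t] show ?thesis unfolding D_def by blast
  qed
  show ?thesis
  proof (rule that[OF e])
    fix n and A B :: "cantor set"
    assume AB: "finite A" "finite B" "inj_on (trunc n) A" "inj_on (trunc n) B"
      "trunc n ` A = trunc n ` B"
    define k where "k = card A"
    obtain s where s: "bij_betw s {..<k} A"
      using ex_bij_betw_nat_finite[OF AB(1)] unfolding k_def atLeast0LessThan by blast
    then have s': "inj_on s {..<k}" "s ` {..<k} = A" by (auto simp: bij_betw_def)
    \<comment> \<open>Lists \<open>B\<close> in the order in which \<open>s\<close> lists
      \<open>A\<close>, so that truncations agree entry by entry.\<close>
    define t where "t i = inv_into B (trunc n) (trunc n (s i))" for i
    have "trunc n (s i) \<in> trunc n ` B" if "i < k" for i
      using that s'(2) AB(5) by blast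
    from inv_into_into[OF this] f_inv_into_f[OF this]
    have t: "t i \<in> B" "trunc n (t i) = trunc n (s i)" if "i < k" for i
      using that by (simp_all add: t_def)
    have inj_s: "inj_on (trunc n \<circ> s) {..<k}"
      by (rule comp_inj_on) (use s' AB(3) in auto)
    then have inj_t: "inj_on t {..<k}"
      using t(2) unfolding inj_on_def by (metis comp_apply lessThan_iff)
    have "card A = card B" using AB(3-5) by (metis card_image)
    then have "t ` {..<k} = B"
      by (intro card_subset_eq AB(2)) (use t(1) card_image[OF inj_t] k_def in auto)
    moreover have "e \<circ> s \<in> tuples k \<F> \<longleftrightarrow> e \<circ> t \<in> tuples k \<F>"
      by (rule hom[OF inj_s]) (simp add: t(2))
    moreover have "inj_on (e \<circ> s) {..<k}" "inj_on (e \<circ> t) {..<k}"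
      using s'(1) inj_t e(1) by (auto intro!: comp_inj_on inj_on_subset[OF e(1)])
    moreover have "(e \<circ> s) ` {..<k} = e ` A" "(e \<circ> t) ` {..<k} = e ` t ` {..<k}"
      by (simp_all only: s'(2) flip: image_comp)
    ultimately show "e ` A \<in> \<F> \<longleftrightarrow> e ` B \<in> \<F>"
      unfolding tuples_def by (simp only: mem_Collect_eq simp_thms)
  qed
qed

section \<open>Dense subtrees\<close>

lemma countable_non_condensation_points:
  fixes S :: "cantor set"
  shows "countable {x\<in>S. \<exists>U. open U \<and> x \<in> U \<and> countable (S \<inter> U)}"
proof -
  define \<B> where "\<B> = (\<Union>n. (\<lambda>z. {y. trunc n y = z}) ` range (trunc n))"
  have \<B>: "countable \<B>"
    unfolding \<B>_def by (intro countable_UN countableI_type countable_finite finite_imageI finite_range_trunc)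
  have "{x\<in>S. \<exists>U. open U \<and> x \<in> U \<and> countable (S \<inter> U)} \<subseteq> (\<Union>B\<in>{B\<in>\<B>. countable (S \<inter> B)}. S \<inter> B)"
  proof
    fix x assume "x \<in> {x\<in>S. \<exists>U. open U \<and> x \<in> U \<and> countable (S \<inter> U)}"
    then obtain U where U: "x \<in> S" "open U" "x \<in> U" "countable (S \<inter> U)" by blast
    from cylinder_subset_open[OF U(2,3)] obtain n where n: "\<forall>y. trunc n y = trunc n x \<longrightarrow> y \<in> U"
      unfolding eventually_sequentially by blast
    define B where "B = {y. trunc n y = trunc n x}"
    have B: "B \<in> \<B>" "x \<in> B" "B \<subseteq> U"
      using n unfolding \<B>_def B_def by auto
    then have "countable (S \<inter> B)" using U(4) by (meson Int_mono countable_subset order_refl)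
    with B U(1) show "x \<in> (\<Union>B\<in>{B\<in>\<B>. countable (S \<inter> B)}. S \<inter> B)" by blast
  qed
  moreover have "countable (\<Union>B\<in>{B\<in>\<B>. countable (S \<inter> B)}. S \<inter> B)"
    using \<B> by (intro countable_UN) (auto intro: countable_subset)
  ultimately show ?thesis by (rule countable_subset)
qed

text \<open>Cantor-Bendixson: removing the countably many points that are not condensation points
  leaves a perfect set, because an isolated point of it would have a neighbourhood meeting
  \<open>S\<close> in a countable set.\<close>

lemma uncountable_closed_contains_perfect:
  fixes S :: "cantor set"
  assumes "closed S" "uncountable S"
  obtains Q where "Q \<subseteq> S" "perfect Q"
proof -
  define N where "N = {x\<in>S. \<exists>U. open U \<and> x \<in> U \<and> countable (S \<inter> U)}"
  have N: "countable N" unfolding N_def by (rule countable_non_condensation_points)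
  have "open (- (S - N))"
  proof (subst open_subopen, intro ballI)
    fix x assume x: "x \<in> - (S - N)"
    show "\<exists>T. open T \<and> x \<in> T \<and> T \<subseteq> - (S - N)"
    proof (cases "x \<in> S")
      case True
      with x obtain U where "open U" "x \<in> U" "countable (S \<inter> U)" unfolding N_def by blast
      then show ?thesis unfolding N_def by (intro exI[of _ U]) blast
    next
      case False
      with assms(1) show ?thesis by (intro exI[of _ "- S"]) (auto simp: open_Compl)
    qed
  qed
  then have "closed (S - N)" by (simp add: closed_def)
  moreover have "S - N \<noteq> {}"
    using assms(2) N by (metis Diff_eq_empty_iff countable_subset)
  moreover have "\<not> x isolated_in (S - N)" for x
  proof
    assume "x isolated_in (S - N)"
    then obtain T where T: "x \<in> S - N" "open T" "T \<inter> (S - N) = {x}"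
      unfolding isolated_in_def by blast
    then have "S \<inter> T \<subseteq> insert x N" by blast
    then have "countable (S \<inter> T)" using N by (meson countable_insert countable_subset)
    with T show False unfolding N_def by blast
  qed
  ultimately have "perfect (S - N)" by (simp add: perfect_def)
  then show ?thesis by (rule that[rotated]) blast
qed

section \<open>Counting nodes in the binary tree\<close>

lemma card_cylinder_le:
  assumes "q \<le> n"
  shows "card {z \<in> range (trunc n). trunc q z = w} \<le> 2 ^ (n - q)"
proof -
  have "{z \<in> range (trunc n). trunc q z = w} \<subseteq> (\<lambda>A i. if i < q then w i else i \<in> A) ` Pow {q..<n}"
  proof
    fix z assume "z \<in> {z \<in> range (trunc n). trunc q z = w}"
    then obtain y where z: "z = trunc n y" and w: "w = trunc q z" by blast
    have "z i = (if i < q then w i else i \<in> {i\<in>{q..<n}. z i})" for i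
      unfolding w by (simp add: z trunc_def)
    then have "z = (\<lambda>i. if i < q then w i else i \<in> {i\<in>{q..<n}. z i})" by (rule ext)
    then show "z \<in> (\<lambda>A i. if i < q then w i else i \<in> A) ` Pow {q..<n}"
      by (rule image_eqI) blast
  qed
  then have "card {z \<in> range (trunc n). trunc q z = w} \<le> card (Pow {q..<n})"
    by (intro surj_card_le) auto
  then show ?thesis by (simp add: card_Pow)
qed

lemma card_range_trunc: "card (range (trunc n)) = 2 ^ n"
proof -
  have "(\<lambda>A i. i \<in> A) ` Pow {..<n} \<subseteq> range (trunc n)"
  proof clarify
    fix A assume "A \<subseteq> {..<n}"
    then have "(\<lambda>i. i \<in> A) = trunc n (\<lambda>i. i \<in> A)" by (auto simp: trunc_def fun_eq_iff)
    then show "(\<lambda>i. i \<in> A) \<in> range (trunc n)" by (metis rangeI)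
  qed
  then have "card ((\<lambda>A i. i \<in> A) ` Pow {..<n}) \<le> card (range (trunc n))"
    by (intro card_mono finite_range_trunc)
  moreover have "inj_on (\<lambda>A i. i \<in> A) (Pow {..<n})"
    by (rule inj_onI) (auto simp: fun_eq_iff)
  ultimately have "2 ^ n \<le> card (range (trunc n))"
    by (simp add: card_image card_Pow)
  moreover have "card (range (trunc n)) \<le> 2 ^ n"
    using card_cylinder_le[of 0 n "\<lambda>_. False"] by (simp add: trunc_def)
  ultimately show ?thesis by simp
qed

text \<open>A node has at most two children, so the proportion of a level that a set occupies does
  not fall under projection to the level below.\<close>

lemma card_trunc_Suc_le:
  assumes "A \<subseteq> range (trunc (Suc n))"
  shows "card A \<le> 2 * card (trunc n ` A)"
proof -
  have "A \<subseteq> (\<lambda>(z, b). z(n := b)) ` ((trunc n ` A) \<times> UNIV)"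
  proof
    fix x assume x: "x \<in> A"
    then obtain y where y: "x = trunc (Suc n) y" using assms by blast
    have "x i = ((trunc n x)(n := x n)) i" for i
      unfolding y by (simp add: trunc_def less_Suc_eq)
    then have "x = (trunc n x)(n := x n)" by (rule ext)
    with x show "x \<in> (\<lambda>(z, b). z(n := b)) ` ((trunc n ` A) \<times> UNIV)"
      by (intro image_eqI[of _ _ "(trunc n x, x n)"]) auto
  qed
  moreover have "finite (trunc n ` A)"
    by (rule finite_subset[OF _ finite_range_trunc[of n]]) blast
  ultimately have "card A \<le> card ((trunc n ` A) \<times> (UNIV :: bool set))"
    by (intro surj_card_le) auto
  then show ?thesis by (simp add: card_cartesian_product)
qed

text \<open>Koenig's lemma for the tree whose vertices at level \<open>n\<close> are the sets in
  \<open>H n\<close>, with projection as predecessor; each level consists of subsets of a finite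
  set.\<close>

lemma koenig_trunc:
  assumes sub: "\<And>n B. B \<in> H n \<Longrightarrow> B \<subseteq> range (trunc n)"
    and nonempty: "\<And>n. H n \<noteq> {}"
    and proj: "\<And>n m B. n \<le> m \<Longrightarrow> B \<in> H m \<Longrightarrow> trunc n ` B \<in> H n"
  obtains b where "\<And>n. b n \<in> H n" "\<And>n. trunc n ` b (Suc n) = b n"
proof -
  have fin: "finite (H n)" for n
    by (rule finite_subset[of _ "Pow (range (trunc n))"]) (use sub finite_range_trunc in auto)
  \<comment> \<open>\<open>C\<close> has extensions at infinitely many levels; by pigeonhole some
    extension of \<open>C\<close> one level up has them too.\<close>
  define G where "G n C \<longleftrightarrow> C \<in> H n \<and> (\<exists>\<^sub>F m in sequentially. \<exists>B\<in>H m. trunc n ` B = C)" for n C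
  have "\<exists>b. \<forall>n. G n (b n) \<and> trunc n ` b (Suc n) = b n"
  proof (rule dependent_nat_choice)
    have "\<exists>\<^sub>F m in sequentially. \<exists>C\<in>H 0. \<exists>B\<in>H m. trunc 0 ` B = C"
    proof (intro eventually_frequently always_eventually allI)
      fix m
      from nonempty obtain B where "B \<in> H m" by blast
      with proj[of 0 m B] show "\<exists>C\<in>H 0. \<exists>B\<in>H m. trunc 0 ` B = C" by blast
    qed simp
    then have "\<exists>C\<in>H 0. \<exists>\<^sub>F m in sequentially. \<exists>B\<in>H m. trunc 0 ` B = C"
      by (rule frequently_bex_finite[OF fin])
    then show "\<exists>C. G 0 C" unfolding G_def by blast
  next
    fix C n assume C: "G n C"
    have "\<exists>\<^sub>F m in sequentially. m \<ge> Suc n \<and> (\<exists>B\<in>H m. trunc n ` B = C)"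
      using C unfolding G_def by (intro frequently_eventually_conj eventually_ge_at_top) simp
    then have "\<exists>\<^sub>F m in sequentially. \<exists>D\<in>{D\<in>H (Suc n). trunc n ` D = C}.
      \<exists>B\<in>H m. trunc (Suc n) ` B = D"
    proof (rule frequently_elim1)
      fix m assume "m \<ge> Suc n \<and> (\<exists>B\<in>H m. trunc n ` B = C)"
      then obtain B where B: "B \<in> H m" "trunc n ` B = C" "m \<ge> Suc n" by blast
      then have "trunc (Suc n) ` B \<in> H (Suc n)" "trunc n ` trunc (Suc n) ` B = C"
        using proj by (auto simp: image_image)
      with B(1) show "\<exists>D\<in>{D\<in>H (Suc n). trunc n ` D = C}. \<exists>B\<in>H m. trunc (Suc n) ` B = D"
        by blast
    qed
    then have "\<exists>D\<in>{D\<in>H (Suc n). trunc n ` D = C}.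
      \<exists>\<^sub>F m in sequentially. \<exists>B\<in>H m. trunc (Suc n) ` B = D"
      by (rule frequently_bex_finite[rotated]) (simp add: fin)
    then show "\<exists>D. G (Suc n) D \<and> trunc n ` D = C" unfolding G_def by blast
  qed
  then show ?thesis using that unfolding G_def by blast
qed

section \<open>Branches through a tree of positive density\<close>

lemma compact_imp_closed_cantor:
  fixes S :: "cantor set"
  assumes "compact S"
  shows "closed S"
proof -
  have "Hausdorff_space (euclidean :: cantor topology)"
    unfolding Hausdorff_space_def
  proof (intro allI impI)
    fix x y :: cantor
    assume "x \<in> topspace euclidean \<and> y \<in> topspace euclidean \<and> x \<noteq> y"
    then obtain n where n: "trunc n x \<noteq> trunc n y"
      using trunc_neq_eventually[of x y] unfolding eventually_sequentially by blast
    then have "disjnt {z. trunc n z = trunc n x} {z. trunc n z = trunc n y}"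
      by (auto simp: disjnt_def)
    then show "\<exists>U V. openin euclidean U \<and> openin euclidean V \<and> x \<in> U \<and> y \<in> V \<and> disjnt U V"
      using open_cylinder[of n x] open_cylinder[of n y]
      by (intro exI[of _ "{z. trunc n z = trunc n x}"] exI[of _ "{z. trunc n z = trunc n y}"]) simp
  qed
  then show ?thesis
    using assms compactin_imp_closedin[of euclidean S] by (simp flip: closed_closedin)
qed

lemma closed_branches: "closed {x. \<forall>n. trunc n x \<in> b n}"
proof -
  have "closed {x. trunc n x \<in> b n}" for n
  proof -
    have "open (\<Union>x\<in>{x. trunc n x \<notin> b n}. {y. trunc n y = trunc n x})"
      by (intro open_UN ballI open_cylinder)
    moreover have "(\<Union>x\<in>{x. trunc n x \<notin> b n}. {y. trunc n y = trunc n x}) = - {x. trunc n x \<in> b n}"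
      by auto
    ultimately show ?thesis by (simp add: closed_def)
  qed
  then show ?thesis by (intro closed_Collect_all)
qed

lemma uncountable_branches:
  assumes \<epsilon>: "\<epsilon> > 0"
    and sub: "\<And>n. b n \<subseteq> range (trunc n)"
    and proj: "\<And>n. trunc n ` b (Suc n) \<subseteq> b n"
    and dense: "\<And>n. \<epsilon> * 2 ^ n \<le> real (card (b n))"
  shows "uncountable {x. \<forall>n. trunc n x \<in> b n}"
proof
  \<comment> \<open>Cover the \<open>i\<close>-th branch by a cylinder of measure \<open>(1/2)^(p+i)\<close>: by compactness these
    cylinders cover some level of the tree, which is too dense for that.\<close>
  assume "countable {x. \<forall>n. trunc n x \<in> b n}"
  then obtain x :: "nat \<Rightarrow> cantor" where x: "{x. \<forall>n. trunc n x \<in> b n} \<subseteq> range x"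
    by (metis empty_subsetI subset_range_from_nat_into)
  \<comment> \<open>The factor 2 is the sum of all (1/2)^i: the cylinders have total measure at most
    2 (1/2)^p < \<epsilon>.\<close>
  obtain p where p: "(1 / 2) ^ p < \<epsilon> / 2"
    using real_arch_pow_inv[of "\<epsilon> / 2" "1 / 2"] \<epsilon> by auto
  define S where "S n = {y. trunc n y \<in> b n}" for n
  have S_mono: "S n \<subseteq> S i" if "i \<le> n" for i n
    using that
  proof (induction n rule: dec_induct)
    case (step n)
    have "y \<in> S n" if "y \<in> S (Suc n)" for y
    proof -
      have "trunc (Suc n) y \<in> b (Suc n)" using that by (simp add: S_def)
      then have "trunc n (trunc (Suc n) y) \<in> trunc n ` b (Suc n)" by (rule imageI)
      then show ?thesis using proj[of n] by (auto simp: S_def)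
    qed
    with step.IH show ?case by blast
  qed simp
  have "open (- S n)" for n
  proof -
    have "- S n = (\<Union>x\<in>- S n. {y. trunc n y = trunc n x})" by (auto simp: S_def)
    then show ?thesis using open_cylinder by (metis open_UN)
  qed
  \<comment> \<open>A branch lies in its own cylinder and any other point in some
    \<open>- S i\<close>, so these sets cover everything. Nodes of \<open>b n\<close> lie in every
    \<open>S i\<close> with \<open>i \<le> n\<close>, hence must be covered by cylinders.\<close>
  then have op: "open ({y. trunc (p + i) y = trunc (p + i) (x i)} \<union> - S i)" for i
    by (intro open_Un open_cylinder)
  have "y \<in> (\<Union>i\<in>UNIV. {y. trunc (p + i) y = trunc (p + i) (x i)} \<union> - S i)" for y
  proof (cases "\<forall>n. y \<in> S n")
    case True
    then have "y \<in> range x" using x by (auto simp: S_def)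
    then obtain i where "y = x i" by blast
    then show ?thesis by auto
  qed blast
  then have "UNIV \<subseteq> (\<Union>i\<in>UNIV. {y. trunc (p + i) y = trunc (p + i) (x i)} \<union> - S i)" by blast
  then obtain I where "I \<subseteq> UNIV" and I: "finite I"
    "UNIV \<subseteq> (\<Union>i\<in>I. {y. trunc (p + i) y = trunc (p + i) (x i)} \<union> - S i)"
    by (rule compactE_image[OF compact_UNIV_cantor op])
  obtain N where N: "\<And>i. i \<in> I \<Longrightarrow> i < N"
    using I(1) unfolding finite_nat_set_iff_bounded by blast
  \<comment> \<open>Deep enough for every selected cylinder, of depth \<open>p + i\<close> with
    \<open>i < N\<close>, to be counted by nodes of level \<open>n\<close>.\<close>
  define n where "n = p + N"
  define Y where "Y i = {z \<in> range (trunc n). trunc (p + i) z = trunc (p + i) (x i)}" for i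
  have "b n \<subseteq> (\<Union>i\<in>I. Y i)"
  proof
    fix z assume z: "z \<in> b n"
    then have z': "z \<in> range (trunc n)" using sub by blast
    then have "trunc n z = z" by auto
    then have "z \<in> S n" using z by (simp add: S_def)
    obtain i where i: "i \<in> I" "z \<in> {y. trunc (p + i) y = trunc (p + i) (x i)} \<union> - S i"
      using I(2) by blast
    have "i \<le> n" using N[OF i(1)] by (simp add: n_def)
    then have "z \<in> S i" using S_mono \<open>z \<in> S n\<close> by blast
    with i z' show "z \<in> (\<Union>i\<in>I. Y i)" by (auto simp: Y_def)
  qed
  moreover have fin: "finite (Y i)" for i
    by (rule finite_subset[OF _ finite_range_trunc[of n]]) (auto simp: Y_def)
  ultimately have "card (b n) \<le> card (\<Union>i\<in>I. Y i)"
    using I(1) by (intro card_mono) auto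
  also have "\<dots> \<le> (\<Sum>i\<in>I. card (Y i))"
    by (rule card_UN_le[OF I(1)])
  finally have "real (card (b n)) \<le> (\<Sum>i\<in>I. real (card (Y i)))"
    by (metis of_nat_mono of_nat_sum)
  also have "\<dots> \<le> (\<Sum>i\<in>I. 2 ^ n * ((1 / 2) ^ p * (1 / 2) ^ i))"
  proof (rule sum_mono)
    fix i assume "i \<in> I"
    then have le: "p + i \<le> n" using N by (simp add: n_def less_imp_le)
    have "card (Y i) \<le> 2 ^ (n - (p + i))"
      unfolding Y_def by (rule card_cylinder_le[OF le])
    then have "real (card (Y i)) \<le> 2 ^ (n - (p + i))" by simp
    also have "\<dots> = 2 ^ n * ((1 / 2) ^ p * (1 / 2) ^ i)"
      using le by (simp add: power_diff power_add power_one_over field_simps)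
    finally show "real (card (Y i)) \<le> 2 ^ n * ((1 / 2) ^ p * (1 / 2) ^ i)" .
  qed
  also have "\<dots> = 2 ^ n * (1 / 2) ^ p * (\<Sum>i\<in>I. (1 / 2) ^ i)"
    by (simp add: sum_distrib_left mult.assoc)
  also have "\<dots> \<le> 2 ^ n * (1 / 2) ^ p * (\<Sum>i. (1 / 2) ^ i)"
    using I(1) by (intro mult_left_mono sum_le_suminf summable_geometric) auto
  also have "\<dots> = 2 ^ n * (1 / 2) ^ p * 2"
    by (simp add: suminf_geometric)
  also have "\<dots> < \<epsilon> * 2 ^ n"
    using p by (simp add: field_simps)
  finally show False using dense[of n] by simp
qed

theorem theoremA:
  fixes \<epsilon> :: real and \<F> :: "cantor set set"
  assumes "\<epsilon> > 0"
    and "filling \<epsilon> \<F>"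
    and "C_measurable_in finsets_topology \<F>"
  shows "\<forall>P :: cantor set. perfect P \<longrightarrow> (\<exists>Q. Q \<subseteq> P \<and> perfect Q \<and> finsets Q \<subseteq> \<F>)"
proof (intro allI impI)
  fix P :: "cantor set" assume P: "perfect P"
  have \<F>_sub: "\<F> \<subseteq> finsets UNIV"
    and hered: "\<And>A B. A \<in> \<F> \<Longrightarrow> B \<subseteq> A \<Longrightarrow> B \<noteq> {} \<Longrightarrow> B \<in> \<F>"
    and fill: "\<And>A. A \<in> finsets UNIV \<Longrightarrow> \<exists>B\<subseteq>A. B \<in> \<F> \<and> real (card B) \<ge> \<epsilon> * real (card A)"
    using assms(2) unfolding filling_def hereditary_def by blast+
  obtain e :: "cantor \<Rightarrow> cantor" where e: "inj e" "continuous_on UNIV e" "range e \<subseteq> P"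
    and hom: "\<And>n A B. finite A \<Longrightarrow> finite B \<Longrightarrow> inj_on (trunc n) A \<Longrightarrow> inj_on (trunc n) B \<Longrightarrow>
      trunc n ` A = trunc n ` B \<Longrightarrow> e ` A \<in> \<F> \<longleftrightarrow> e ` B \<in> \<F>"
    using homogeneous_embedding[OF P assms(3)] by metis
  have hom_trunc: "e ` A \<in> \<F> \<longleftrightarrow> e ` trunc n ` A \<in> \<F>" if "finite A" "inj_on (trunc n) A" for n A
    using that by (intro hom) (auto simp: inj_on_def image_image)
  define H where "H n = {B. B \<subseteq> range (trunc n) \<and> e ` B \<in> \<F> \<and> \<epsilon> * 2 ^ n \<le> real (card B)}" for n
  have H_nonempty: "H n \<noteq> {}" for n
  proof -
    have "e ` range (trunc n) \<in> finsets UNIV"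
      using finite_range_trunc[of n] by (auto simp: finsets_eq)
    from fill[OF this] obtain B where B: "B \<subseteq> e ` range (trunc n)" "B \<in> \<F>"
      "\<epsilon> * real (card (e ` range (trunc n))) \<le> real (card B)" by blast
    obtain A where A: "A \<subseteq> range (trunc n)" "B = e ` A"
      using B(1) by (meson subset_imageE)
    have "card (e ` X) = card X" for X
      using e(1) by (meson card_image inj_on_subset subset_UNIV)
    with A B have "A \<in> H n" by (simp add: H_def card_range_trunc)
    then show ?thesis by blast
  qed
  have proj_Suc: "trunc n ` B \<in> H n" if B: "B \<in> H (Suc n)" for n B
  proof -
    \<comment> \<open>\<open>trunc n\<close> may merge nodes of \<open>B\<close>, whereas
      homogeneity requires it to be injective; \<open>B\<close> is thinned to one preimage per
      projected node, which heredity allows.\<close>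
    obtain A where A: "A \<subseteq> B" "inj_on (trunc n) A" "trunc n ` B = trunc n ` A"
      using subset_image_inj[of "trunc n ` B" "trunc n" B] by auto
    have "finite A" "A \<noteq> {}"
      using A B \<F>_sub finite_subset[OF _ finite_range_trunc[of "Suc n"]]
      by (auto simp: H_def finsets_eq)
    have "e ` A \<in> \<F>"
      by (rule hered[of "e ` B"]) (use A(1) B \<open>A \<noteq> {}\<close> in \<open>auto simp: H_def\<close>)
    then have "e ` trunc n ` B \<in> \<F>"
      using hom_trunc[OF \<open>finite A\<close> A(2)] by (simp add: A(3))
    moreover have "\<epsilon> * 2 ^ n \<le> real (card (trunc n ` B))"
      using card_trunc_Suc_le[of B n] B unfolding H_def by simp
    ultimately show ?thesis unfolding H_def by blast
  qed
  have proj: "trunc n ` B \<in> H n" if "n \<le> m" "B \<in> H m" for n m B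
    using that
  proof (induction m arbitrary: B rule: dec_induct)
    case base
    then have "trunc n ` B = B" by (force simp: H_def)
    with base show ?case by simp
  next
    case (step m)
    from step.IH[OF proj_Suc[OF step.prems]] show ?case
      using step.hyps by (simp add: image_image)
  qed
  obtain b where b: "\<And>n. b n \<in> H n" "\<And>n. trunc n ` b (Suc n) = b n"
    by (rule koenig_trunc[of H]) (use H_nonempty proj in \<open>auto simp: H_def\<close>)
  define K where "K = {x. \<forall>n. trunc n x \<in> b n}"
  have "uncountable K"
    unfolding K_def using b
    by (intro uncountable_branches[OF assms(1)]) (auto simp: H_def)
  then have unc: "uncountable (e ` K)"
    using e(1) by (metis countable_image_inj_on inj_on_subset subset_UNIV)
  have "closed (e ` K)"
  proof -
    have "compact K"
      using closed_Int_compact[OF closed_branches compact_UNIV_cantor] unfolding K_def by simp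
    from compact_continuous_image[OF continuous_on_subset[OF e(2) subset_UNIV] this]
    show ?thesis by (rule compact_imp_closed_cantor)
  qed
  then obtain Q where Q: "Q \<subseteq> e ` K" "perfect Q"
    using unc by (rule uncountable_closed_contains_perfect)
  have "F \<in> \<F>" if F: "F \<in> finsets Q" for F
  proof -
    have F': "F \<subseteq> e ` K" "finite F" "F \<noteq> {}" using F Q(1) by (auto simp: finsets_eq)
    obtain A where A: "A \<subseteq> K" "finite A" "F = e ` A"
      using finite_subset_image[OF F'(2,1)] by blast
    \<comment> \<open>At a level separating \<open>A\<close>, its truncation is part of
      \<open>b n\<close>, whose image is in \<open>\<F>\<close>. Heredity passes to the truncation,
      homogeneity back to \<open>A\<close>.\<close>
    obtain n where n: "inj_on (trunc n) A"
      using inj_on_trunc_eventually[OF A(2)] unfolding eventually_sequentially by blast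
    have "e ` trunc n ` A \<in> \<F>"
    proof (rule hered)
      show "e ` b n \<in> \<F>" using b(1)[of n] by (simp add: H_def)
      show "e ` trunc n ` A \<subseteq> e ` b n" using A(1) by (auto simp: K_def)
      show "e ` trunc n ` A \<noteq> {}" using F'(3) A(3) by simp
    qed
    then show ?thesis using hom_trunc[OF A(2) n] A(3) by simp
  qed
  with Q e(3) show "\<exists>Q. Q \<subseteq> P \<and> perfect Q \<and> finsets Q \<subseteq> \<F>" by blast
qed

end
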